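(* Let $A$ be an ordered alphabet with an order-preserving involution, let $V:=F(A^{\ast})$, and let $F$ be a final segment of $A^{\ast}$ with $F\neq A^{\ast}$. Let $\mathcal S_F$ be the injective envelope of the two-element $V$-metric space $(\{x,y\},d)$ with $d(x,y)=F$, let $\mathcal M_F$ be its associated transition system and $\mathcal G_F$ its graph, and let $\mathcal A_F:=(\mathcal M_F,\{x\},\{y\})$ (which accepts $F$). Then the following are equivalent: (i) $F$ is irreducible; (ii) $\mathcal S_F$ is irreducible; (iii) $\mathcal G_F$ has no cut vertex. Moreover, if $F$ is not irreducible, the blocks of $\mathcal G_F$ can be enumerated as $C_0,\dots,C_{n-1}$ with $n\ge 2$ so that they form a path (consecutive blocks meet in exactly one vertex), $x\in C_0$ and $y\in C_{n-1}$; and $F=F_0F_1\cdots F_{n-1}$ where, setting $x_0:=x$, $y_{n-1}:=y$, $\{x_i\}:=C_{i-1}\cap C_i$ for $i\ge1$ and $\{y_i\}:=C_i\cap C_{i+1}$ for $i\le n-2$, the automaton $\mathcal A_{F_i}$ accepting $F_i$ is isomorphic to $(\mathcal M_F\restriction C_i,\{x_i\},\{y_i\})$.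
   Context: Higman ordering on $A^{\ast}$: $a_0\cdots a_{n-1}\le b_0\cdots b_{m-1}$ iff there is a strictly increasing $h$ with $a_i\le b_{h(i)}$. $F(A^{\ast})$ is the set of final (upward closed) subsets of $A^{\ast}$, a monoid under concatenation $XY=\{\alpha\beta\}$ with neutral element $A^{\ast}$, ordered by reverse inclusion ($X\le Y$ iff $X\supseteq Y$); the involution extends to words by $\overline{a_0\cdots a_{n-1}}=\overline{a_{n-1}}\cdots\overline{a_0}$ and to sets elementwise. A final segment $F$ is irreducible if $F\ne A^{\ast}$ and $F=F_1F_2$ with $F_1,F_2\in F(A^{\ast})$ implies $F=F_1$ or $F=F_2$. A $V$-metric space is a set $E$ with $d:E^2\to V$ such that $d(x,y)=A^{\ast}$ iff $x=y$, $d(x,y)\supseteq d(x,z)d(z,y)$, and $d(x,y)=\overline{d(y,x)}$. A map $f$ between $V$-metric spaces is non-expansive if $d'(f(x),f(y))\supseteq d(x,y)$, an isometry if equality holds. A space $E$ is injective if for every isometry $g:E'\to E''$ and non-expansive $f:E'\to E$ there is non-expansive $h:E''\to E$ with $h\circ g=f$. An injective envelope of $E$ is an isometric embedding $f:E\to E'$ into an injective space $E'$ such that for every non-expansive $g$ on $E'$, $g\circ f$ is an isometry iff $g$ is; it exists and is unique up to isometry fixing $E$. If $E_1,E_2$ are $V$-metric spaces meeting in exactly one point $z$, $E_1\cdot E_2$ is $E_1\cup E_2$ with $d(u,v):=d_i(u,v)$ for $u,v\in E_i$ and $d(u,v):=d_i(u,z)d_j(z,v)$ for $u\in E_i,v\in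 E_j$, $i\ne j$. A metric space $E$ is irreducible if it has more than one element and $E=E_1\cdot E_2$ (as subspaces) implies $E=E_1$ or $E=E_2$. The transition system of a $V$-metric space $(E,d)$ has state set $E$ and transitions $(p,a,q)$ for $a\in A\cap d(p,q)$; its graph has an edge between $p$ and $q$ whenever some transition links them (it is undirected with a loop at each vertex). An automaton $(M,\{x\},\{y\})$ accepts the set of labels of paths of transitions from $x$ to $y$; isomorphism of automata is a bijection on states preserving transitions both ways and initial/final states. A cut vertex of a graph is a vertex whose deletion increases the number of connected components; a block is a maximal connected induced subgraph without cut vertex. *)

theory Defs
  imports Main "HOL-Library.Equipollence" "HOL-Library.Sublist"
begin

definition higman_le :: "'a::order list \<Rightarrow> 'a list \<Rightarrow> bool" where
  "higman_le u v \<longleftrightarrow>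
     (\<exists>h::nat \<Rightarrow> nat. strict_mono_on {..<length u} h \<and>
        (\<forall>i<length u. h i < length v \<and> u ! i \<le> v ! h i))"

definition final_segment :: "'a::order list set \<Rightarrow> bool" where
  "final_segment X \<longleftrightarrow> (\<forall>u\<in>X. \<forall>v. higman_le u v \<longrightarrow> v \<in> X)"

definition conc :: "'a list set \<Rightarrow> 'a list set \<Rightarrow> 'a list set" where
  "conc X Y = {u @ v | u v. u \<in> X \<and> v \<in> Y}"

text \<open>The neutral element of the monoid of final segments is the set of all words, so
  this is also the value of the empty product.\<close>

definition conc_list :: "'a list set list \<Rightarrow> 'a list set" where
  "conc_list Xs = foldr conc Xs UNIV"

definition bar_set :: "('a \<Rightarrow> 'a) \<Rightarrow> 'a list set \<Rightarrow> 'a list set" where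
  "bar_set bar X = (\<lambda>w. rev (map bar w)) ` X"

definition order_involution :: "('a::order \<Rightarrow> 'a) \<Rightarrow> bool" where
  "order_involution bar \<longleftrightarrow> mono bar \<and> (\<forall>a. bar (bar a) = a)"

definition irreducible_segment :: "'a::order list set \<Rightarrow> bool" where
  "irreducible_segment F \<longleftrightarrow> final_segment F \<and> F \<noteq> UNIV \<and>
     (\<forall>F1 F2. final_segment F1 \<and> final_segment F2 \<and> F = conc F1 F2 \<longrightarrow> F = F1 \<or> F = F2)"

definition vmetric :: "('a::order \<Rightarrow> 'a) \<Rightarrow> 'p set \<Rightarrow> ('p \<Rightarrow> 'p \<Rightarrow> 'a list set) \<Rightarrow> bool" where
  "vmetric bar E d \<longleftrightarrow>
     (\<forall>p\<in>E. \<forall>q\<in>E. final_segment (d p q)) \<and>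
     (\<forall>p\<in>E. \<forall>q\<in>E. d p q = UNIV \<longleftrightarrow> p = q) \<and>
     (\<forall>p\<in>E. \<forall>q\<in>E. \<forall>r\<in>E. conc (d p r) (d r q) \<subseteq> d p q) \<and>
     (\<forall>p\<in>E. \<forall>q\<in>E. d p q = bar_set bar (d q p))"

definition nonexpansive ::
  "'p set \<Rightarrow> ('p \<Rightarrow> 'p \<Rightarrow> 'a list set) \<Rightarrow> 'q set \<Rightarrow> ('q \<Rightarrow> 'q \<Rightarrow> 'a list set) \<Rightarrow> ('p \<Rightarrow> 'q) \<Rightarrow> bool" where
  "nonexpansive E d E' d' f \<longleftrightarrow>
     f ` E \<subseteq> E' \<and> (\<forall>p\<in>E. \<forall>q\<in>E. d p q \<subseteq> d' (f p) (f q))"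

definition isometry ::
  "'p set \<Rightarrow> ('p \<Rightarrow> 'p \<Rightarrow> 'a list set) \<Rightarrow> 'q set \<Rightarrow> ('q \<Rightarrow> 'q \<Rightarrow> 'a list set) \<Rightarrow> ('p \<Rightarrow> 'q) \<Rightarrow> bool" where
  "isometry E d E' d' f \<longleftrightarrow>
     f ` E \<subseteq> E' \<and> (\<forall>p\<in>E. \<forall>q\<in>E. d' (f p) (f q) = d p q)"

text \<open>A definition cannot quantify over types, so the test spaces below have their points in
  a fixed type determined by the type of the points of \<open>E\<close>.  The lemmas
  \<open>injective_space_extend\<close> and \<open>injective_envelope_essential\<close> show
  that both definitions imply the corresponding property for test spaces with points in
  arbitrary types.\<close>

definition injective_space ::
  "('a::order \<Rightarrow> 'a) \<Rightarrow> 'p set \<Rightarrow> ('p \<Rightarrow> 'p \<Rightarrow> 'a list set) \<Rightarrow> bool" where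
  "injective_space bar E d \<longleftrightarrow> vmetric bar E d \<and>
     (\<forall>(E' :: 'p option set) d' (E'' :: 'p option set) d'' g f.
        vmetric bar E' d' \<and> vmetric bar E'' d'' \<and>
        isometry E' d' E'' d'' g \<and> nonexpansive E' d' E d f \<longrightarrow>
        (\<exists>h. nonexpansive E'' d'' E d h \<and> (\<forall>u\<in>E'. h (g u) = f u)))"

definition injective_envelope ::
  "('a::order \<Rightarrow> 'a) \<Rightarrow> 'p set \<Rightarrow> ('p \<Rightarrow> 'p \<Rightarrow> 'a list set) \<Rightarrow>
   'q set \<Rightarrow> ('q \<Rightarrow> 'q \<Rightarrow> 'a list set) \<Rightarrow> ('p \<Rightarrow> 'q) \<Rightarrow> bool" where
  "injective_envelope bar E d E' d' f \<longleftrightarrow>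
     vmetric bar E d \<and> injective_space bar E' d' \<and> isometry E d E' d' f \<and>
     (\<forall>(G :: 'q set) dG g. vmetric bar G dG \<and> nonexpansive E' d' G dG g \<longrightarrow>
        (isometry E d G dG (g \<circ> f) \<longleftrightarrow> isometry E' d' G dG g))"

datatype endpoint = Left_End | Right_End

definition pair_dist ::
  "('a \<Rightarrow> 'a) \<Rightarrow> 'a list set \<Rightarrow> endpoint \<Rightarrow> endpoint \<Rightarrow> 'a list set" where
  "pair_dist bar F p q =
     (if p = q then UNIV else if p = Left_End then F else bar_set bar F)"

text \<open>\<open>(E, d)\<close> is an injective envelope of the two-element space whose two points,
  at distance \<open>F\<close>, are sent to \<open>x\<close> and \<open>y\<close>.\<close>

definition pair_envelope ::
  "('a::order \<Rightarrow> 'a) \<Rightarrow> 'a list set \<Rightarrow> 'p set \<Rightarrow> ('p \<Rightarrow> 'p \<Rightarrow> 'a list set) \<Rightarrow> 'p \<Rightarrow> 'p \<Rightarrow> bool" where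
  "pair_envelope bar F E d x y \<longleftrightarrow>
     injective_envelope bar UNIV (pair_dist bar F) E d
       (\<lambda>p. case p of Left_End \<Rightarrow> x | Right_End \<Rightarrow> y)"

definition glued_dist ::
  "'p set \<Rightarrow> ('p \<Rightarrow> 'p \<Rightarrow> 'a list set) \<Rightarrow> 'p set \<Rightarrow> ('p \<Rightarrow> 'p \<Rightarrow> 'a list set) \<Rightarrow> 'p \<Rightarrow>
   'p \<Rightarrow> 'p \<Rightarrow> 'a list set" where
  "glued_dist E1 d1 E2 d2 z u v =
     (if u \<in> E1 \<and> v \<in> E1 then d1 u v
      else if u \<in> E2 \<and> v \<in> E2 then d2 u v
      else if u \<in> E1 then conc (d1 u z) (d2 z v)
      else conc (d2 u z) (d1 z v))"

definition is_product ::
  "'p set \<Rightarrow> ('p \<Rightarrow> 'p \<Rightarrow> 'a list set) \<Rightarrow> 'p set \<Rightarrow> 'p set \<Rightarrow> bool" where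
  "is_product E d E1 E2 \<longleftrightarrow>
     E = E1 \<union> E2 \<and>
     (\<exists>z. E1 \<inter> E2 = {z} \<and> (\<forall>u\<in>E. \<forall>v\<in>E. d u v = glued_dist E1 d E2 d z u v))"

definition irreducible_space :: "'p set \<Rightarrow> ('p \<Rightarrow> 'p \<Rightarrow> 'a list set) \<Rightarrow> bool" where
  "irreducible_space E d \<longleftrightarrow>
     (\<exists>p\<in>E. \<exists>q\<in>E. p \<noteq> q) \<and>
     (\<forall>E1 E2. is_product E d E1 E2 \<longrightarrow> E = E1 \<or> E = E2)"

type_synonym ('p, 'a) transitions = "('p \<times> 'a \<times> 'p) set"

definition space_trans ::
  "'p set \<Rightarrow> ('p \<Rightarrow> 'p \<Rightarrow> 'a list set) \<Rightarrow> ('p, 'a) transitions" where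
  "space_trans E d = {(p, a, q). p \<in> E \<and> q \<in> E \<and> [a] \<in> d p q}"

definition restrict_trans :: "('p, 'a) transitions \<Rightarrow> 'p set \<Rightarrow> ('p, 'a) transitions" where
  "restrict_trans T C = {(p, a, q). (p, a, q) \<in> T \<and> p \<in> C \<and> q \<in> C}"

record ('p, 'a) automaton =
  states :: "'p set"
  trans :: "('p, 'a) transitions"
  initial :: "'p set"
  accepting :: "'p set"

definition mk_automaton ::
  "'p set \<Rightarrow> ('p, 'a) transitions \<Rightarrow> 'p set \<Rightarrow> 'p set \<Rightarrow> ('p, 'a) automaton" where
  "mk_automaton Q T I J = \<lparr>states = Q, trans = T, initial = I, accepting = J\<rparr>"

fun path_label :: "('p, 'a) transitions \<Rightarrow> 'p \<Rightarrow> 'a list \<Rightarrow> 'p \<Rightarrow> bool" where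
  "path_label T p [] q \<longleftrightarrow> p = q"
| "path_label T p (a # w) q \<longleftrightarrow> (\<exists>r. (p, a, r) \<in> T \<and> path_label T r w q)"

definition accepted :: "('p, 'a) automaton \<Rightarrow> 'a list set" where
  "accepted M = {w. \<exists>p\<in>initial M. \<exists>q\<in>accepting M. path_label (trans M) p w q}"

definition automata_isomorphic :: "('p, 'a) automaton \<Rightarrow> ('q, 'a) automaton \<Rightarrow> bool" where
  "automata_isomorphic M N \<longleftrightarrow>
     (\<exists>\<phi>. bij_betw \<phi> (states M) (states N) \<and>
        (\<forall>p\<in>states M. \<forall>a. \<forall>q\<in>states M. (p, a, q) \<in> trans M \<longleftrightarrow> (\<phi> p, a, \<phi> q) \<in> trans N) \<and>
        (\<forall>p\<in>states M. p \<in> initial M \<longleftrightarrow> \<phi> p \<in> initial N) \<and>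
        (\<forall>p\<in>states M. p \<in> accepting M \<longleftrightarrow> \<phi> p \<in> accepting N))"

text \<open>A graph is a vertex set \<open>V\<close> with a symmetric edge relation \<open>R\<close>; only the
  part of \<open>R\<close> inside \<open>V\<close> matters, so that the subgraph induced on \<open>C\<close> is given
  by \<open>C\<close> and the same \<open>R\<close>.\<close>

definition trans_graph :: "('p, 'a) transitions \<Rightarrow> ('p \<times> 'p) set" where
  "trans_graph T = {(p, q). \<exists>a. (p, a, q) \<in> T \<or> (q, a, p) \<in> T}"

definition reachable_in :: "'v set \<Rightarrow> ('v \<times> 'v) set \<Rightarrow> ('v \<times> 'v) set" where
  "reachable_in V R = {(u, v). u \<in> V \<and> v \<in> V \<and> (u, v) \<in> (R \<inter> V \<times> V)\<^sup>*}"

definition components :: "'v set \<Rightarrow> ('v \<times> 'v) set \<Rightarrow> 'v set set" where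
  "components V R = V // reachable_in V R"

definition connected_graph :: "'v set \<Rightarrow> ('v \<times> 'v) set \<Rightarrow> bool" where
  "connected_graph V R \<longleftrightarrow> (\<exists>C. components V R = {C})"

text \<open>Deleting a vertex may leave infinitely many components, hence the comparison of
  cardinalities by \<open>\<prec>\<close> rather than by \<open>card\<close>.\<close>

definition cut_vertex :: "'v set \<Rightarrow> ('v \<times> 'v) set \<Rightarrow> 'v \<Rightarrow> bool" where
  "cut_vertex V R v \<longleftrightarrow> v \<in> V \<and> components V R \<prec> components (V - {v}) R"

definition block :: "'v set \<Rightarrow> ('v \<times> 'v) set \<Rightarrow> 'v set \<Rightarrow> bool" where
  "block V R C \<longleftrightarrow>
     C \<subseteq> V \<and> connected_graph C R \<and> (\<nexists>v. cut_vertex C R v) \<and>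
     (\<forall>D. C \<subseteq> D \<and> D \<subseteq> V \<and> connected_graph D R \<and> (\<nexists>v. cut_vertex D R v) \<longrightarrow> D = C)"

lemma higman_le_list_emb: "list_emb (\<le>) u v \<Longrightarrow> higman_le u v"
proof (induction rule: list_emb.induct)
  case (list_emb_Nil ys)
  then show ?case by (simp add: higman_le_def strict_mono_on_def)
next
  case (list_emb_Cons xs ys y)
  then obtain h where "strict_mono_on {..<length xs} h"
    "\<forall>i<length xs. h i < length ys \<and> xs ! i \<le> ys ! h i"
    by (auto simp: higman_le_def)
  then show ?case unfolding higman_le_def
    by (intro exI[of _ "Suc \<circ> h"]) (auto simp: strict_mono_on_def)
next
  case (list_emb_Cons2 x y xs ys)
  then obtain h where h: "strict_mono_on {..<length xs} h"
    "\<forall>i<length xs. h i < length ys \<and> xs ! i \<le> ys ! h i"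
    by (auto simp: higman_le_def)
  show ?case unfolding higman_le_def
  proof (intro exI[of _ "\<lambda>i. case i of 0 \<Rightarrow> 0 | Suc j \<Rightarrow> Suc (h j)"] conjI)
    show "strict_mono_on {..<length (x # xs)} (\<lambda>i. case i of 0 \<Rightarrow> 0 | Suc j \<Rightarrow> Suc (h j))"
      using h(1) by (auto simp: strict_mono_on_def split: nat.splits)
  qed (use h list_emb_Cons2 in \<open>auto split: nat.splits\<close>)
qed

lemma list_emb_higman_le:
  assumes "higman_le u v" shows "list_emb (\<le>) u v"
proof -
  obtain h where h: "strict_mono_on {..<length u} h"
    "\<forall>i<length u. h i < length v \<and> u ! i \<le> v ! h i"
    using assms by (auto simp: higman_le_def)
  have "list_emb (\<le>) (drop (length u - k) u)
          (drop (if k = 0 then length v else h (length u - k)) v)" if "k \<le> length u" for k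
    using that
  proof (induction k)
    case 0
    then show ?case by simp
  next
    case (Suc k)
    let ?i = "length u - Suc k"
    have i: "?i < length u" "Suc ?i = length u - k" using Suc.prems by auto
    have hi: "h ?i < length v" "u ! ?i \<le> v ! h ?i" using h(2) i(1) by auto
    have le: "Suc (h ?i) \<le> (if k = 0 then length v else h (length u - k))"
    proof (cases k)
      case (Suc m)
      then have "h ?i < h (length u - k)"
        using h(1) i by (intro strict_mono_onD[OF h(1)]) auto
      then show ?thesis using Suc by simp
    qed (use hi in simp)
    have IH: "list_emb (\<le>) (drop (length u - k) u)
          (drop (if k = 0 then length v else h (length u - k)) v)" using Suc by simp
    have "suffix (drop (if k = 0 then length v else h (length u - k)) v) (drop (Suc (h ?i)) v)"
      using le by (metis drop_drop le_add_diff_inverse2 suffix_drop)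
    then have "list_emb (\<le>) (drop (Suc ?i) u) (drop (Suc (h ?i)) v)"
      using IH i(2) by (metis list_emb_append2 suffix_def)
    then have "list_emb (\<le>) (u ! ?i # drop (Suc ?i) u) (v ! h ?i # drop (Suc (h ?i)) v)"
      using hi(2) by auto
    then show ?case using Cons_nth_drop_Suc[OF i(1)] Cons_nth_drop_Suc[OF hi(1)] by simp
  qed
  from this[of "length u"] show ?thesis
    using list_emb_append2[of "(\<le>)" u "drop (h 0) v" "take (h 0) v"]
    by (cases "u = []") auto
qed

lemma higman_le_iff_list_emb: "higman_le u v \<longleftrightarrow> list_emb (\<le>) u v"
  using higman_le_list_emb list_emb_higman_le by blast

lemma conc_assoc: "conc (conc X Y) Z = conc X (conc Y Z)"
  unfolding conc_def by (auto, metis append.assoc, metis append.assoc)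

lemma conc_mono: "X \<subseteq> X' \<Longrightarrow> Y \<subseteq> Y' \<Longrightarrow> conc X Y \<subseteq> conc X' Y'"
  unfolding conc_def by blast

lemma final_segment_conc:
  assumes "final_segment X" "final_segment Y" shows "final_segment (conc X Y)"
  unfolding final_segment_def
proof (intro ballI allI impI)
  fix u v assume "u \<in> conc X Y" "higman_le u v"
  then obtain a b where "u = a @ b" "a \<in> X" "b \<in> Y" "list_emb (\<le>) (a @ b) v"
    by (auto simp: conc_def higman_le_iff_list_emb)
  then obtain a' b' where "v = a' @ b'" "list_emb (\<le>) a a'" "list_emb (\<le>) b b'"
    by (meson list_emb_appendD)
  moreover from this have "a' \<in> X" "b' \<in> Y" using assms \<open>a \<in> X\<close> \<open>b \<in> Y\<close>
    by (auto simp: final_segment_def higman_le_iff_list_emb)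
  ultimately show "v \<in> conc X Y" unfolding conc_def by blast
qed

lemma conc_UNIV_right:
  assumes "final_segment X" shows "conc X UNIV = X"
proof -
  have "u @ v \<in> X" if "u \<in> X" for u v
    using assms that list_emb_prefix[of "(\<le>)" u u v] list_emb_refl[of u "(\<le>)"]
    by (auto simp: final_segment_def higman_le_iff_list_emb)
  moreover have "u \<in> conc X UNIV" if "u \<in> X" for u
    using that by (auto simp: conc_def intro: exI[of _ u])
  ultimately show ?thesis by (auto simp: conc_def)
qed

lemma conc_UNIV_left:
  assumes "final_segment X" shows "conc UNIV X = X"
proof -
  have "u @ v \<in> X" if "v \<in> X" for u v
    using assms that list_emb_append2[of "(\<le>)" v v u] list_emb_refl[of v "(\<le>)"]
    by (auto simp: final_segment_def higman_le_iff_list_emb)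
  moreover have "u \<in> conc UNIV X" if "u \<in> X" for u
    using that by (auto simp: conc_def intro: exI[of _ "[]"])
  ultimately show ?thesis by (auto simp: conc_def)
qed

lemma bar_set_bar_set:
  assumes "order_involution bar" shows "bar_set bar (bar_set bar X) = X"
proof -
  have "bar \<circ> bar = id" using assms by (auto simp: order_involution_def)
  then show ?thesis by (simp add: bar_set_def image_image rev_map[symmetric])
qed

lemma bar_set_conc: "bar_set bar (conc X Y) = conc (bar_set bar Y) (bar_set bar X)"
proof -
  have "rev (map bar (u @ v)) = rev (map bar v) @ rev (map bar u)" for u v by simp
  then have "w \<in> bar_set bar (conc X Y) \<longleftrightarrow> w \<in> conc (bar_set bar Y) (bar_set bar X)" for w
    unfolding bar_set_def conc_def image_iff mem_Collect_eq bex_simps by metis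
  then show ?thesis by blast
qed

lemma bar_set_mono: "X \<subseteq> Y \<Longrightarrow> bar_set bar X \<subseteq> bar_set bar Y"
  unfolding bar_set_def by blast

lemma final_segment_bar:
  assumes "order_involution bar" "final_segment X" shows "final_segment (bar_set bar X)"
  unfolding final_segment_def
proof (intro ballI allI impI)
  have bb: "bar (bar a) = a" and mb: "a \<le> b \<Longrightarrow> bar a \<le> bar b" for a b
    using assms(1) by (auto simp: order_involution_def mono_def)
  fix u v assume "u \<in> bar_set bar X" "higman_le u v"
  then obtain w where w: "w \<in> X" "u = rev (map bar w)" by (auto simp: bar_set_def)
  obtain h where h: "strict_mono_on {..<length u} h"
    "\<forall>i<length u. h i < length v \<and> u ! i \<le> v ! h i"
    using \<open>higman_le u v\<close> by (auto simp: higman_le_def)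
  let ?n = "length u" and ?m = "length v"
  have "higman_le w (rev (map bar v))"
    unfolding higman_le_def
  proof (intro exI[of _ "\<lambda>i. ?m - Suc (h (?n - Suc i))"] conjI allI impI)
    show "strict_mono_on {..<length w} (\<lambda>i. ?m - Suc (h (?n - Suc i)))"
    proof (rule strict_mono_onI)
      fix r s assume rs: "r \<in> {..<length w}" "s \<in> {..<length w}" "r < s"
      then have "h (?n - Suc s) < h (?n - Suc r)"
        using w(2) by (intro strict_mono_onD[OF h(1)]) auto
      moreover have "h (?n - Suc r) < ?m" using h(2) rs w(2) by auto
      ultimately show "?m - Suc (h (?n - Suc r)) < ?m - Suc (h (?n - Suc s))" by linarith
    qed
  next
    fix i assume i: "i < length w"
    have *: "h (?n - Suc i) < ?m" "u ! (?n - Suc i) \<le> v ! h (?n - Suc i)"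
      using h(2) i w(2) by auto
    then show "?m - Suc (h (?n - Suc i)) < length (rev (map bar v))" by simp
    have "u ! (?n - Suc i) = bar (w ! i)" using i w(2) by (simp add: rev_nth)
    then have "w ! i \<le> bar (v ! h (?n - Suc i))" using *(2) mb bb by metis
    then show "w ! i \<le> rev (map bar v) ! (?m - Suc (h (?n - Suc i)))"
      using *(1) by (simp add: rev_nth)
  qed
  then have "rev (map bar v) \<in> X" using assms(2) w(1) by (auto simp: final_segment_def)
  moreover have "v = rev (map bar (rev (map bar v)))"
    by (simp add: rev_map[symmetric] o_def bb)
  ultimately show "v \<in> bar_set bar X" unfolding bar_set_def by blast
qed

text \<open>The distance from \<open>z\<close> to \<open>e\<close> in the one-point extension below is the
  largest final segment compatible with the constraints collected in \<open>S\<close>.\<close>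

lemma injective_one_point:
  fixes d :: "'p \<Rightarrow> 'p \<Rightarrow> 'a::order list set"
  assumes bar: "order_involution bar" and inj: "injective_space bar E d"
    and S: "fst ` S \<subseteq> E" "\<And>a r. (a, r) \<in> S \<Longrightarrow> final_segment r"
      "\<And>a r b s. (a, r) \<in> S \<Longrightarrow> (b, s) \<in> S \<Longrightarrow> conc r (bar_set bar s) \<subseteq> d a b"
  shows "\<exists>e\<in>E. \<forall>(a, r)\<in>S. r \<subseteq> d a e"
proof -
  have vm: "vmetric bar E d" using inj by (simp add: injective_space_def)
  have fin: "final_segment (d p q)" if "p \<in> E" "q \<in> E" for p q
    using vm that unfolding vmetric_def by blast
  have tri: "conc (d p r) (d r q) \<subseteq> d p q" if "p \<in> E" "q \<in> E" "r \<in> E" for p q r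
    using vm that unfolding vmetric_def by blast
  have sym: "d p q = bar_set bar (d q p)" if "p \<in> E" "q \<in> E" for p q
    using vm that unfolding vmetric_def by blast
  have UN: "d p q = UNIV \<longleftrightarrow> p = q" if "p \<in> E" "q \<in> E" for p q
    using vm that unfolding vmetric_def by blast
  define \<delta> where "\<delta> e = (\<Union>(a, r)\<in>S. conc (d e a) r)" for e
  have SE: "a \<in> E" if "(a, r) \<in> S" for a r using S(1) that by force
  have \<delta>_fin: "final_segment (\<delta> e)" if "e \<in> E" for e
  proof -
    have "final_segment (conc (d e a) r)" if "(a, r) \<in> S" for a r
      using final_segment_conc[OF fin S(2)] that SE \<open>e \<in> E\<close> by blast
    then show ?thesis unfolding \<delta>_def final_segment_def by fast
  qed
  have \<delta>_ge: "r \<subseteq> \<delta> a" if "(a, r) \<in> S" for a r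
  proof -
    have "conc (d a a) r = r" using UN[of a a] SE[OF that] conc_UNIV_left[OF S(2)[OF that]] by simp
    then show ?thesis unfolding \<delta>_def using that by blast
  qed
  have \<delta>1: "conc (d e e') (\<delta> e') \<subseteq> \<delta> e" if "e \<in> E" "e' \<in> E" for e e'
  proof
    fix w assume "w \<in> conc (d e e') (\<delta> e')"
    then obtain a r where ar: "(a, r) \<in> S" "w \<in> conc (d e e') (conc (d e' a) r)"
      unfolding conc_def \<delta>_def by blast
    have "conc (d e e') (conc (d e' a) r) \<subseteq> conc (d e a) r"
      unfolding conc_assoc[symmetric] using tri that SE[OF ar(1)] by (intro conc_mono) auto
    then show "w \<in> \<delta> e" using ar unfolding \<delta>_def by blast
  qed
  have \<delta>2: "conc (\<delta> e) (bar_set bar (\<delta> e')) \<subseteq> d e e'" if "e \<in> E" "e' \<in> E" for e e'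
  proof
    fix w assume "w \<in> conc (\<delta> e) (bar_set bar (\<delta> e'))"
    then obtain a r b s where ab: "(a, r) \<in> S" "(b, s) \<in> S"
      "w \<in> conc (conc (d e a) r) (bar_set bar (conc (d e' b) s))"
      unfolding conc_def \<delta>_def bar_set_def by blast
    have E: "a \<in> E" "b \<in> E" using SE ab by auto
    have eq: "bar_set bar (conc (d e' b) s) = conc (bar_set bar s) (d b e')"
      using sym[of b e'] E that by (simp add: bar_set_conc)
    have "conc (conc (d e a) r) (bar_set bar (conc (d e' b) s))
        = conc (d e a) (conc (conc r (bar_set bar s)) (d b e'))"
      unfolding eq by (simp add: conc_assoc)
    also have "\<dots> \<subseteq> conc (d e a) (conc (d a b) (d b e'))"
      using S(3)[OF ab(1,2)] by (intro conc_mono) auto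
    also have "\<dots> \<subseteq> conc (d e a) (d a e')"
      using tri E that by (intro conc_mono) auto
    also have "\<dots> \<subseteq> d e e'" using tri E that by auto
    finally show "w \<in> d e e'" using ab(3) by blast
  qed
  have bb: "bar_set bar (bar_set bar X) = X" for X by (rule bar_set_bar_set[OF bar])
  have bU: "bar_set bar UNIV = UNIV"
  proof -
    have "X \<subseteq> bar_set bar UNIV" for X
      using bb[of X] bar_set_mono[of "bar_set bar X" UNIV bar] by simp
    then show ?thesis by blast
  qed
  show ?thesis
  proof (cases "\<exists>e\<in>E. \<delta> e = UNIV")
    case True
    then obtain e where e: "e \<in> E" "\<delta> e = UNIV" by blast
    have "\<delta> a \<subseteq> d a e" if "a \<in> E" for a
      using \<delta>2[OF that e(1)] unfolding e(2) bU conc_UNIV_right[OF \<delta>_fin[OF that]] .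
    then have "\<forall>(a, r)\<in>S. r \<subseteq> d a e" using \<delta>_ge SE by blast
    then show ?thesis using e(1) by blast
  next
    case False
    define D where "D p q = (case (p, q) of
        (Some a, Some b) \<Rightarrow> d a b
      | (Some a, None) \<Rightarrow> \<delta> a
      | (None, Some b) \<Rightarrow> bar_set bar (\<delta> b)
      | (None, None) \<Rightarrow> UNIV)" for p q
    have Dsimps [simp]: "D (Some a) (Some b) = d a b" "D (Some a) None = \<delta> a"
      "D None (Some b) = bar_set bar (\<delta> b)" "D None None = UNIV" for a b
      by (simp_all add: D_def)
    have neU: "bar_set bar (\<delta> e) \<noteq> UNIV" if "e \<in> E" for e
      using False that bb[of "\<delta> e"] bU by metis
    have UNf: "final_segment (UNIV :: 'a list set)" by (simp add: final_segment_def)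
    have t3: "conc (bar_set bar (\<delta> b)) (d b e) \<subseteq> bar_set bar (\<delta> e)" if "b \<in> E" "e \<in> E" for b e
      using bar_set_mono[OF \<delta>1[OF that(2,1)], of bar] sym[OF that] by (simp add: bar_set_conc)
    let ?E' = "Some ` E" and ?E'' = "insert None (Some ` E)"
    have vm': "vmetric bar ?E' D"
      using vm unfolding vmetric_def ball_simps Dsimps option.inject .
    have "vmetric bar ?E'' D"
      unfolding vmetric_def
    proof (intro conjI)
      show "\<forall>p\<in>?E''. \<forall>q\<in>?E''. final_segment (D p q)"
        using fin \<delta>_fin UNf final_segment_bar[OF bar \<delta>_fin] by auto
      show "\<forall>p\<in>?E''. \<forall>q\<in>?E''. D p q = UNIV \<longleftrightarrow> p = q"
        using UN False neU by auto
      show "\<forall>p\<in>?E''. \<forall>q\<in>?E''. D p q = bar_set bar (D q p)"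
      proof (intro ballI)
        fix p q assume "p \<in> ?E''" "q \<in> ?E''"
        then show "D p q = bar_set bar (D q p)"
          using bb bU by (cases p; cases q) (simp_all, (rule sym; blast)?)
      qed
      show "\<forall>p\<in>?E''. \<forall>q\<in>?E''. \<forall>r\<in>?E''. conc (D p r) (D r q) \<subseteq> D p q"
        unfolding ball_simps Dsimps
        using tri \<delta>1 \<delta>2 t3 conc_UNIV_right[OF \<delta>_fin]
          conc_UNIV_left[OF final_segment_bar[OF bar \<delta>_fin]] by simp
    qed
    moreover have "isometry ?E' D ?E'' D id" by (auto simp: isometry_def)
    moreover have "nonexpansive ?E' D E d the" by (auto simp: nonexpansive_def)
    ultimately obtain h where h: "nonexpansive ?E'' D E d h" "\<forall>u\<in>?E'. h (id u) = the u"
      using vm' inj unfolding injective_space_def by blast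
    have "h None \<in> E" using h(1) by (auto simp: nonexpansive_def)
    moreover have "r \<subseteq> d a (h None)" if "(a, r) \<in> S" for a r
    proof -
      have "D (Some a) None \<subseteq> d (h (Some a)) (h None)"
        using h(1) SE[OF that] by (simp add: nonexpansive_def)
      then show ?thesis using h(2) SE[OF that] \<delta>_ge[OF that] by simp
    qed
    ultimately show ?thesis by blast
  qed
qed

lemma injective_space_extend:
  fixes d :: "'p \<Rightarrow> 'p \<Rightarrow> 'a::order list set" and E' :: "'s set" and E'' :: "'t set"
  assumes bar: "order_involution bar" and inj: "injective_space bar E d"
    and "vmetric bar E' d'" and vm2: "vmetric bar E'' d''"
    and g: "isometry E' d' E'' d'' g" and f: "nonexpansive E' d' E d f"
  shows "\<exists>h. nonexpansive E'' d'' E d h \<and> (\<forall>u\<in>E'. h (g u) = f u)"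
proof -
  have vm: "vmetric bar E d" using inj by (simp add: injective_space_def)
  have UN: "d p q = UNIV \<longleftrightarrow> p = q" if "p \<in> E" "q \<in> E" for p q
    using vm that unfolding vmetric_def by blast
  have UN2: "d'' p q = UNIV \<longleftrightarrow> p = q" if "p \<in> E''" "q \<in> E''" for p q
    using vm2 that unfolding vmetric_def by blast
  define ok where "ok T \<longleftrightarrow> T \<subseteq> E'' \<times> E \<and>
      (\<forall>(u, a)\<in>T. \<forall>(v, b)\<in>T. d'' u v \<subseteq> d a b)" for T
  define T0 where "T0 = (\<lambda>u. (g u, f u)) ` E'"
  have T0: "ok T0" using g f unfolding ok_def T0_def isometry_def nonexpansive_def by auto
  have "\<exists>M\<in>{T. ok T \<and> T0 \<subseteq> T}. \<forall>X\<in>{T. ok T \<and> T0 \<subseteq> T}. M \<subseteq> X \<longrightarrow> X = M"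
  proof (rule subset_Zorn_nonempty)
    fix \<C> assume C: "\<C> \<noteq> {}" "subset.chain {T. ok T \<and> T0 \<subseteq> T} \<C>"
    have "d'' u v \<subseteq> d a b" if "(u, a) \<in> \<Union>\<C>" "(v, b) \<in> \<Union>\<C>" for u v a b
    proof -
      obtain X Y where XY: "X \<in> \<C>" "Y \<in> \<C>" "(u, a) \<in> X" "(v, b) \<in> Y" using \<open>(u, a) \<in> \<Union>\<C>\<close> \<open>(v, b) \<in> \<Union>\<C>\<close> by blast
      then have "X \<subseteq> Y \<or> Y \<subseteq> X" using C(2) by (auto simp: subset_chain_def)
      moreover have "ok X" "ok Y" using XY C(2) by (auto simp: subset_chain_def)
      ultimately show ?thesis using XY(3,4) unfolding ok_def by blast
    qed
    moreover have "\<Union>\<C> \<subseteq> E'' \<times> E" "T0 \<subseteq> \<Union>\<C>"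
      using C unfolding subset_chain_def ok_def by blast+
    ultimately show "\<Union>\<C> \<in> {T. ok T \<and> T0 \<subseteq> T}" unfolding ok_def by blast
  qed (use T0 in blast)
  then obtain T where T: "ok T" "T0 \<subseteq> T"
    and T': "\<forall>X\<in>{T. ok T \<and> T0 \<subseteq> T}. T \<subseteq> X \<longrightarrow> X = T" by auto
  have Tmax: "X = T" if "ok X" "T \<subseteq> X" for X
    using T' that T(2) by (metis (mono_tags, lifting) mem_Collect_eq subset_trans)
  have TE: "u \<in> E''" "a \<in> E" if "(u, a) \<in> T" for u a using T(1) that by (auto simp: ok_def)
  have Tle: "d'' u v \<subseteq> d a b" if "(u, a) \<in> T" "(v, b) \<in> T" for u v a b
    using T(1) that unfolding ok_def by blast
  have dom: "\<exists>a. (z, a) \<in> T" if z: "z \<in> E''" for z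
  proof -
    define S where "S = (\<lambda>(u, a). (a, d'' u z)) ` T"
    have tri2: "conc (d'' u z) (bar_set bar (d'' v z)) \<subseteq> d'' u v" if "u \<in> E''" "v \<in> E''" for u v
    proof -
      have "bar_set bar (d'' v z) = d'' z v" using vm2 z that unfolding vmetric_def by blast
      then show ?thesis using vm2 z that unfolding vmetric_def by metis
    qed
    have "\<exists>e\<in>E. \<forall>(a, r)\<in>S. r \<subseteq> d a e"
    proof (rule injective_one_point[OF bar inj])
      show "fst ` S \<subseteq> E" unfolding S_def using TE by auto
      show "final_segment r" if "(a, r) \<in> S" for a r
      proof -
        obtain u where "(u, a) \<in> T" "r = d'' u z" using \<open>(a, r) \<in> S\<close> unfolding S_def by auto
        then show ?thesis using vm2 z TE(1) unfolding vmetric_def by blast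
      qed
      show "conc r (bar_set bar s) \<subseteq> d a b" if "(a, r) \<in> S" "(b, s) \<in> S" for a r b s
      proof -
        obtain u v where uv: "(u, a) \<in> T" "(v, b) \<in> T" "r = d'' u z" "s = d'' v z"
          using \<open>(a, r) \<in> S\<close> \<open>(b, s) \<in> S\<close> unfolding S_def by auto
        show ?thesis using tri2[OF TE(1)[OF uv(1)] TE(1)[OF uv(2)]] Tle[OF uv(1,2)] uv(3,4) by blast
      qed
    qed
    then obtain e where e: "e \<in> E" "\<And>u a. (u, a) \<in> T \<Longrightarrow> d'' u z \<subseteq> d a e"
      unfolding S_def by fastforce
    have e': "d'' z u \<subseteq> d e a" if "(u, a) \<in> T" for u a
    proof -
      have "d'' z u = bar_set bar (d'' u z)" "d e a = bar_set bar (d a e)"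
        using vm vm2 z e(1) TE[OF that] unfolding vmetric_def by blast+
      then show ?thesis using bar_set_mono[OF e(2)[OF that]] by simp
    qed
    have "ok (insert (z, e) T)"
    proof -
      have "d'' u v \<subseteq> d a b" if "(u, a) \<in> insert (z, e) T" "(v, b) \<in> insert (z, e) T" for u v a b
        using that e(2) e' UN[OF e(1) e(1)] Tle by blast
      moreover have "insert (z, e) T \<subseteq> E'' \<times> E" using T(1) z e(1) by (auto simp: ok_def)
      ultimately show ?thesis unfolding ok_def by blast
    qed
    then have "insert (z, e) T = T" using Tmax by blast
    then show ?thesis by blast
  qed
  define h where "h u = (SOME a. (u, a) \<in> T)" for u
  have h: "(u, h u) \<in> T" if "u \<in> E''" for u
    unfolding h_def using dom[OF that] by (rule someI_ex)
  have "nonexpansive E'' d'' E d h"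
    unfolding nonexpansive_def
  proof (intro conjI ballI)
    show "h ` E'' \<subseteq> E" using TE(2)[OF h] by blast
    show "d'' u v \<subseteq> d (h u) (h v)" if "u \<in> E''" "v \<in> E''" for u v
      using Tle[OF h[OF that(1)] h[OF that(2)]] .
  qed
  moreover have "h (g u) = f u" if "u \<in> E'" for u
  proof -
    have a: "(g u, f u) \<in> T" using T(2) that by (auto simp: T0_def)
    have b: "(g u, h (g u)) \<in> T" using h TE(1)[OF a] .
    have "d (h (g u)) (f u) = UNIV" using Tle[OF b a] UN2[of "g u" "g u"] TE(1)[OF a] by auto
    then show ?thesis using UN TE a b by blast
  qed
  ultimately show ?thesis by blast
qed

lemma injective_envelope_essential:
  fixes G :: "'t set" and E' :: "'q set"
  assumes env: "injective_envelope bar E d E' d' f"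
    and G: "vmetric bar G dG" and g: "nonexpansive E' d' G dG g"
  shows "isometry E d G dG (g \<circ> f) \<longleftrightarrow> isometry E' d' G dG g"
proof -
  define r where "r = inv_into E' g"
  define E1 where "E1 = r ` g ` E'"
  define d1 where "d1 p q = dG (g p) (g q)" for p q
  have r: "r (g p) \<in> E'" "g (r (g p)) = g p" if "p \<in> E'" for p
    using that unfolding r_def by (auto simp: inv_into_into f_inv_into_f)
  have inj: "p = q" if "p \<in> E1" "q \<in> E1" "g p = g q" for p q
    using that r unfolding E1_def by auto
  have gG: "g p \<in> G" if "p \<in> E1" for p using that r g unfolding E1_def nonexpansive_def by blast
  have "vmetric bar E1 d1"
    unfolding vmetric_def
  proof (intro conjI ballI)
    fix p q assume pq: "p \<in> E1" "q \<in> E1"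
    show "final_segment (d1 p q)" "d1 p q = bar_set bar (d1 q p)"
      using G gG[OF pq(1)] gG[OF pq(2)] unfolding vmetric_def d1_def by blast+
    have "d1 p q = UNIV \<longleftrightarrow> g p = g q"
      using G gG[OF pq(1)] gG[OF pq(2)] unfolding vmetric_def d1_def by blast
    then show "d1 p q = UNIV \<longleftrightarrow> p = q" using inj[OF pq] by blast
    show "conc (d1 p r) (d1 r q) \<subseteq> d1 p q" if "r \<in> E1" for r
      using G gG[OF pq(1)] gG[OF pq(2)] gG[OF that] unfolding vmetric_def d1_def by blast
  qed
  moreover have "nonexpansive E' d' E1 d1 (r \<circ> g)"
    using g r unfolding nonexpansive_def E1_def d1_def by auto
  ultimately have *: "isometry E d E1 d1 ((r \<circ> g) \<circ> f) \<longleftrightarrow> isometry E' d' E1 d1 (r \<circ> g)"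
    using env unfolding injective_envelope_def by blast
  have fE: "f p \<in> E'" if "p \<in> E" for p
    using env that unfolding injective_envelope_def isometry_def by blast
  have rg: "r (g p) \<in> E1" "d1 (r (g p)) (r (g q)) = dG (g p) (g q)" "g p \<in> G"
    if "p \<in> E'" "q \<in> E'" for p q
    using that r g unfolding E1_def d1_def nonexpansive_def by auto
  have "isometry E d E1 d1 ((r \<circ> g) \<circ> f) \<longleftrightarrow> (\<forall>p\<in>E. \<forall>q\<in>E. dG (g (f p)) (g (f q)) = d p q)"
    using rg fE unfolding isometry_def o_def image_subset_iff by metis
  moreover have "isometry E d G dG (g \<circ> f) \<longleftrightarrow> (\<forall>p\<in>E. \<forall>q\<in>E. dG (g (f p)) (g (f q)) = d p q)"
    using rg fE unfolding isometry_def o_def image_subset_iff by metis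
  moreover have "isometry E' d' E1 d1 (r \<circ> g) \<longleftrightarrow> (\<forall>p\<in>E'. \<forall>q\<in>E'. dG (g p) (g q) = d' p q)"
    using rg unfolding isometry_def o_def image_subset_iff by metis
  moreover have "isometry E' d' G dG g \<longleftrightarrow> (\<forall>p\<in>E'. \<forall>q\<in>E'. dG (g p) (g q) = d' p q)"
    using rg unfolding isometry_def image_subset_iff by metis
  ultimately show ?thesis using * by simp
qed

end

theory Submission
  imports Defs
begin

text \<open>A point \<open>e\<close> of the envelope is determined by the final segment \<open>X = d x e\<close>, and the
  segments that occur are those for which \<open>X\<close> and \<open>Y = d e y\<close> are the largest with
  \<open>X Y \<subseteq> F\<close>, each given the other. Injectivity makes \<open>d p q\<close> the set of
  labels of paths from \<open>p\<close> to \<open>q\<close>, so a vertex \<open>v\<close> separating \<open>x\<close> from \<open>y\<close> factors \<open>F\<close> as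
  \<open>d x v\<close> times \<open>d v y\<close>. Conversely, comparing with words of minimal length shows that concatenation
  of nonempty final segments is cancellative; hence both factors of \<open>F = P S\<close> belong to a point
  \<open>v\<close>, with which every point is comparable and across which no edge jumps. A factorization of
  \<open>F\<close> into irreducibles yields a chain of such points. The interval between consecutive ones is a
  retract of the envelope and is itself the envelope of the corresponding factor, hence without
  cut vertex, and every connected subgraph without cut vertex lies in one of these intervals.\<close>

section \<open>Final segments and residuals\<close>

lemma final_segment_UNIV [simp]: "final_segment UNIV"
  by (simp add: final_segment_def)

lemma final_segmentD: "final_segment X \<Longrightarrow> u \<in> X \<Longrightarrow> list_emb (\<le>) u v \<Longrightarrow> v \<in> X"
  by (auto simp: final_segment_def higman_le_iff_list_emb)

lemma final_segment_append_right: "final_segment X \<Longrightarrow> u \<in> X \<Longrightarrow> u @ v \<in> X"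
  by (erule final_segmentD, assumption) (simp add: list_emb_prefix list_emb_refl)

lemma final_segment_append_left: "final_segment X \<Longrightarrow> v \<in> X \<Longrightarrow> u @ v \<in> X"
  by (erule final_segmentD, assumption) (simp add: list_emb_append2 list_emb_refl)

lemma final_segment_Nil_iff: "final_segment X \<Longrightarrow> [] \<in> X \<longleftrightarrow> X = UNIV"
  using final_segmentD[of X "[]"] by auto

section \<open>Words under the involution, residuals, and the metric on final segments\<close>

definition bar_word :: "('a \<Rightarrow> 'a) \<Rightarrow> 'a list \<Rightarrow> 'a list" where
  "bar_word bar w = rev (map bar w)"

lemma bar_word_bar_word: "order_involution bar \<Longrightarrow> bar_word bar (bar_word bar w) = w"
  by (simp add: bar_word_def order_involution_def rev_map[symmetric] o_def)

lemma bar_word_append: "bar_word bar (u @ v) = bar_word bar v @ bar_word bar u"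
  by (simp add: bar_word_def)

lemma bar_word_Nil [simp]: "bar_word bar [] = []"
  by (simp add: bar_word_def)

lemma mem_bar_set_iff:
  assumes "order_involution bar" shows "w \<in> bar_set bar X \<longleftrightarrow> bar_word bar w \<in> X"
  unfolding bar_set_def image_iff bar_word_def[symmetric] using bar_word_bar_word[OF assms] by metis

text \<open>The largest \<open>Z\<close> with \<open>conc X Z \<subseteq> Y\<close>; its mirror
  image \<open>left_residual\<close> is the largest \<open>Z\<close> with
  \<open>conc Z X \<subseteq> Y\<close>.\<close>

definition residual :: "'a list set \<Rightarrow> 'a list set \<Rightarrow> 'a list set" where
  "residual X Y = {w. \<forall>u\<in>X. u @ w \<in> Y}"

definition left_residual :: "'a list set \<Rightarrow> 'a list set \<Rightarrow> 'a list set" where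
  "left_residual Y X = {w. \<forall>v\<in>X. w @ v \<in> Y}"

lemma residualD: "w \<in> residual X Y \<Longrightarrow> u \<in> X \<Longrightarrow> u @ w \<in> Y"
  by (simp add: residual_def)

lemma left_residualD: "w \<in> left_residual Y X \<Longrightarrow> v \<in> X \<Longrightarrow> w @ v \<in> Y"
  by (simp add: left_residual_def)

lemma final_segment_residual: "final_segment Y \<Longrightarrow> final_segment (residual X Y)"
  unfolding final_segment_def residual_def higman_le_iff_list_emb
  by (blast intro: list_emb_append_mono list_emb_refl order_refl)

lemma final_segment_left_residual: "final_segment Y \<Longrightarrow> final_segment (left_residual Y X)"
  unfolding final_segment_def left_residual_def higman_le_iff_list_emb
  by (blast intro: list_emb_append_mono list_emb_refl order_refl)

lemma residual_UNIV:
  assumes "final_segment Y" shows "residual UNIV Y = Y"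
proof -
  have "w \<in> Y" if "w \<in> residual UNIV Y" for w
    using residualD[OF that, of "[]"] by simp
  moreover have "w \<in> residual UNIV Y" if "w \<in> Y" for w
    using final_segment_append_left[OF assms that] by (simp add: residual_def)
  ultimately show ?thesis by blast
qed

text \<open>The closure operator of the Galois connection formed by the two residuals into
  \<open>F\<close>. Its final fixed points turn out to be the distances \<open>d x e\<close> in the
  envelope.\<close>

definition seg_closure :: "'a list set \<Rightarrow> 'a list set \<Rightarrow> 'a list set" where
  "seg_closure F X = left_residual F (residual X F)"

lemma seg_closure_increasing: "X \<subseteq> seg_closure F X"
  by (auto simp: seg_closure_def left_residual_def residual_def)

lemma seg_closure_idem: "seg_closure F (seg_closure F X) = seg_closure F X"
  by (auto simp: seg_closure_def left_residual_def residual_def)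

lemma final_segment_seg_closure: "final_segment F \<Longrightarrow> final_segment (seg_closure F X)"
  by (simp add: seg_closure_def final_segment_left_residual)

lemma seg_closure_UNIV: "seg_closure F UNIV = UNIV"
  using seg_closure_increasing by blast

lemma seg_closure_self:
  assumes "final_segment F" shows "seg_closure F F = F"
proof -
  have "[] \<in> residual F F" by (simp add: residual_def)
  then have "seg_closure F F \<subseteq> F"
    unfolding seg_closure_def using left_residualD[of _ F "residual F F" "[]"] by auto
  then show ?thesis using seg_closure_increasing by blast
qed

text \<open>If \<open>X\<close> followed by \<open>w\<close> lies in \<open>Y\<close>, then
  \<open>w\<close> followed by \<open>residual Y F\<close> lies in \<open>residual X F\<close>. This
  makes the passage to closures nonexpansive.\<close>

lemma residual_seg_closure:
  assumes "w \<in> residual X Y" shows "w \<in> residual (seg_closure F X) (seg_closure F Y)"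
proof -
  have "u @ w @ v \<in> F" if "u \<in> seg_closure F X" "v \<in> residual Y F" for u v
  proof -
    have "w @ v \<in> residual X F"
      using residualD[OF assms] residualD[OF that(2)] by (fastforce simp: residual_def)
    then show ?thesis using that(1) by (simp add: seg_closure_def left_residual_def)
  qed
  then show ?thesis unfolding residual_def[of "seg_closure F X"]
    by (simp add: seg_closure_def left_residual_def)
qed

text \<open>The canonical distance on final segments: \<open>residual X Y\<close> alone obeys the
  triangle inequality but is not symmetric, which the barred reverse residual repairs.\<close>

definition seg_dist :: "('a \<Rightarrow> 'a) \<Rightarrow> 'a list set \<Rightarrow> 'a list set \<Rightarrow> 'a list set" where
  "seg_dist bar X Y = residual X Y \<inter> bar_set bar (residual Y X)"

text \<open>A final segment \<open>X\<close> absorbs every word on the right, so for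
  \<open>Y \<subseteq> X\<close> the reverse residual is \<open>UNIV\<close>.\<close>

lemma seg_dist_antimono:
  assumes "order_involution bar" "final_segment X" "Y \<subseteq> X"
  shows "seg_dist bar X Y = residual X Y"
proof -
  have "residual Y X = UNIV"
    using assms(3) final_segment_append_right[OF assms(2)] by (auto simp: residual_def)
  then show ?thesis by (auto simp: seg_dist_def mem_bar_set_iff[OF assms(1)])
qed

lemma vmetric_seg_dist:
  assumes bar: "order_involution bar"
  shows "vmetric bar {X :: 'a::order list set. final_segment X} (seg_dist bar)"
  unfolding vmetric_def
proof (intro conjI ballI)
  fix X Y :: "'a list set" assume XY: "X \<in> {X. final_segment X}" "Y \<in> {X. final_segment X}"
  have "final_segment (residual X Y)" "final_segment (bar_set bar (residual Y X))"
    using XY by (auto intro: final_segment_residual final_segment_bar[OF bar])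
  then show fin: "final_segment (seg_dist bar X Y)"
    unfolding seg_dist_def final_segment_def by blast
  \<comment> \<open>A final segment is \<open>UNIV\<close> iff it contains \<open>[]\<close>, and
    \<open>[]\<close> lies in both residuals iff \<open>X\<close> and \<open>Y\<close> contain each
    other.\<close>
  show "seg_dist bar X Y = UNIV \<longleftrightarrow> X = Y"
    unfolding final_segment_Nil_iff[OF fin, symmetric]
    by (auto simp: seg_dist_def mem_bar_set_iff[OF bar] residual_def)
  show "seg_dist bar X Y = bar_set bar (seg_dist bar Y X)"
    by (auto simp: seg_dist_def mem_bar_set_iff[OF bar] bar_word_bar_word[OF bar])
  fix Z :: "'a list set"
  have "u @ v \<in> seg_dist bar X Y" if "u \<in> seg_dist bar X Z" "v \<in> seg_dist bar Z Y" for u v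
  proof -
    have "a @ u @ v \<in> Y" if "a \<in> X" for a
      using \<open>u \<in> _\<close> \<open>v \<in> _\<close> that residualD append_assoc unfolding seg_dist_def by (metis IntD1)
    moreover have "a @ bar_word bar v @ bar_word bar u \<in> X" if "a \<in> Y" for a
      using \<open>u \<in> _\<close> \<open>v \<in> _\<close> that residualD append_assoc unfolding seg_dist_def mem_bar_set_iff[OF bar]
      by (metis IntD2 mem_bar_set_iff[OF bar])
    ultimately show ?thesis
      by (auto simp: seg_dist_def mem_bar_set_iff[OF bar] bar_word_append residual_def[of X] residual_def[of Y])
  qed
  then show "conc (seg_dist bar X Z) (seg_dist bar Z Y) \<subseteq> seg_dist bar X Y"
    unfolding conc_def by blast
qed

subsection \<open>Cancellation\<close>

lemma exists_shortest:
  assumes "X \<noteq> {}" obtains w where "w \<in> X" "\<And>v. v \<in> X \<Longrightarrow> length w \<le> length v"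
  using assms ex_has_least_nat[of "\<lambda>w. w \<in> X" _ length] by blast

lemma append_eq_append_prefix:
  assumes "u @ v = p @ s" "length v \<le> length s" shows "\<exists>t. u = p @ t"
  using assms by (auto simp: append_eq_append_conv2)

lemma append_eq_append_suffix:
  assumes "u @ v = p @ s" "length u \<le> length p" shows "\<exists>t. v = t @ s"
  using assms by (auto simp: append_eq_append_conv2)

text \<open>Both cancellation laws compare with a word of minimal length in the cancelled factor.\<close>

lemma left_residual_conc:
  assumes "final_segment P" "S \<noteq> {}" shows "left_residual (conc P S) S = P"
proof -
  obtain w where w: "w \<in> S" "\<And>v. v \<in> S \<Longrightarrow> length w \<le> length v"
    using exists_shortest[OF assms(2)] by blast
  have "u \<in> P" if u: "u \<in> left_residual (conc P S) S" for u
  proof -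
    obtain p s where "u @ w = p @ s" "p \<in> P" "s \<in> S"
      using left_residualD[OF u w(1)] by (auto simp: conc_def)
    \<comment> \<open>As \<open>w\<close> is no longer than \<open>s\<close>, the word
      \<open>u\<close> reaches at least to the end of \<open>p\<close>.\<close>
    then obtain t where "u = p @ t" using append_eq_append_prefix w(2) by blast
    then show ?thesis using final_segment_append_right[OF assms(1) \<open>p \<in> P\<close>] by simp
  qed
  then show ?thesis by (auto simp: left_residual_def conc_def)
qed

lemma residual_conc:
  assumes "final_segment S" "P \<noteq> {}" shows "residual P (conc P S) = S"
proof -
  obtain w where w: "w \<in> P" "\<And>v. v \<in> P \<Longrightarrow> length w \<le> length v"
    using exists_shortest[OF assms(2)] by blast
  have "u \<in> S" if u: "u \<in> residual P (conc P S)" for u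
  proof -
    obtain p s where "w @ u = p @ s" "p \<in> P" "s \<in> S"
      using residualD[OF u w(1)] by (auto simp: conc_def)
    then obtain t where "u = t @ s" using append_eq_append_suffix w(2) by blast
    then show ?thesis using final_segment_append_left[OF assms(1) \<open>s \<in> S\<close>] by simp
  qed
  then show ?thesis by (auto simp: residual_def conc_def)
qed

lemma conc_empty_iff: "conc X Y = {} \<longleftrightarrow> X = {} \<or> Y = {}"
  by (auto simp: conc_def)

text \<open>A shortest word of \<open>P\<close> is lost: writing it as \<open>p @ s\<close> would
  force \<open>s = []\<close>, which \<open>S \<noteq> UNIV\<close> excludes. The strictness later
  keeps the points of the chain apart.\<close>

lemma conc_left_proper:
  assumes "final_segment P" "final_segment S" "conc P S \<noteq> {}" "S \<noteq> UNIV"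
  shows "conc P S \<subset> P"
proof -
  have ne: "P \<noteq> {}" "S \<noteq> {}" using assms(3) by (auto simp: conc_empty_iff)
  obtain w where w: "w \<in> P" "\<And>v. v \<in> P \<Longrightarrow> length w \<le> length v"
    using exists_shortest[OF ne(1)] by blast
  have "w \<notin> conc P S"
  proof
    assume "w \<in> conc P S"
    then obtain p s where "w = p @ s" "p \<in> P" "s \<in> S" by (auto simp: conc_def)
    then have "s = []" using w(2)[of p] by simp
    then show False using \<open>s \<in> S\<close> final_segment_Nil_iff[OF assms(2)] assms(4) by simp
  qed
  moreover have "conc P S \<subseteq> P"
    using final_segment_append_right[OF assms(1)] by (auto simp: conc_def)
  ultimately show ?thesis using w(1) by blast
qed

section \<open>Products of several segments and factorization into irreducibles\<close>

lemma final_segment_conc_list: "\<forall>X\<in>set Xs. final_segment X \<Longrightarrow> final_segment (conc_list Xs)"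
  by (induction Xs) (auto simp: conc_list_def final_segment_conc)

lemma conc_list_Nil [simp]: "conc_list [] = UNIV"
  and conc_list_Cons [simp]: "conc_list (X # Xs) = conc X (conc_list Xs)"
  by (simp_all add: conc_list_def)

lemma conc_list_append:
  assumes "\<forall>X\<in>set Ys. final_segment X"
  shows "conc_list (Xs @ Ys) = conc (conc_list Xs) (conc_list Ys)"
  using conc_UNIV_left[OF final_segment_conc_list[OF assms]]
  by (induction Xs) (simp_all add: conc_assoc)

text \<open>Induction on the length of a word of \<open>F\<close>: a nontrivial factorization cuts
  it into nonempty words of the two factors, both shorter.\<close>

lemma irreducible_factorization:
  assumes "final_segment F" "F \<noteq> UNIV" "F \<noteq> {}"
  shows "\<exists>L. L \<noteq> [] \<and> (\<forall>X\<in>set L. irreducible_segment X) \<and> conc_list L = F"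
proof -
  obtain w where "w \<in> F" using assms(3) by blast
  with assms show ?thesis
  proof (induction "length w" arbitrary: w F rule: less_induct)
    case less
    show ?case
    proof (cases "irreducible_segment F")
      case True
      then show ?thesis using less.prems by (intro exI[of _ "[F]"]) (simp add: conc_UNIV_right)
    next
      case False
      then obtain P S where PS: "final_segment P" "final_segment S" "F = conc P S" "F \<noteq> P" "F \<noteq> S"
        using less.prems unfolding irreducible_segment_def by blast
      have ne: "P \<noteq> UNIV" "S \<noteq> UNIV"
        using PS conc_UNIV_left[OF PS(2)] conc_UNIV_right[OF PS(1)] by auto
      obtain p s where ps: "w = p @ s" "p \<in> P" "s \<in> S"
        using less.prems(4) PS(3) by (auto simp: conc_def)
      have "p \<noteq> []" "s \<noteq> []"
        using ps ne final_segment_Nil_iff PS(1,2) by metis+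
      then have len: "length p < length w" "length s < length w" using ps(1) by auto
      obtain L1 where L1: "L1 \<noteq> []" "\<forall>X\<in>set L1. irreducible_segment X" "conc_list L1 = P"
        using less.hyps[OF len(1) PS(1) ne(1) _ ps(2)] ps(2) by blast
      obtain L2 where L2: "\<forall>X\<in>set L2. irreducible_segment X" "conc_list L2 = S"
        using less.hyps[OF len(2) PS(2) ne(2) _ ps(3)] ps(3) by blast
      have "conc_list (L1 @ L2) = F"
        using conc_list_append[of L2 L1] L1 L2 PS(3) by (auto simp: irreducible_segment_def)
      then show ?thesis using L1 L2 by (intro exI[of _ "L1 @ L2"]) auto
    qed
  qed
qed

section \<open>The envelope of a two-point space\<close>

text \<open>Being isometric on the two endpoints concerns only the distance from \<open>x\<close> to
  \<open>y\<close>, the opposite one following by the involution; and a map isometric on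
  \<open>E\<close> is automatically isometric on the endpoints.\<close>

lemma pair_envelope_iff:
  fixes E :: "'q set"
  assumes bar: "order_involution bar" and F: "final_segment F" "F \<noteq> UNIV"
  shows "pair_envelope bar F E d x y \<longleftrightarrow> injective_space bar E d \<and> x \<in> E \<and> y \<in> E \<and> d x y = F \<and>
    (\<forall>(G :: 'q set) dG g. vmetric bar G dG \<and> nonexpansive E d G dG g \<and> dG (g x) (g y) = F
      \<longrightarrow> isometry E d G dG g)"
proof -
  let ?f = "case_endpoint x y"
  have bU: "bar_set bar UNIV = UNIV" by (auto simp: mem_bar_set_iff[OF bar])
  have bF: "bar_set bar F \<noteq> UNIV" using F(2) bar_set_bar_set[OF bar, of F] bU by metis
  have UNe: "(UNIV :: endpoint set) = {Left_End, Right_End}"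
    using endpoint.exhaust by blast
  have vp: "vmetric bar UNIV (pair_dist bar F)"
    unfolding vmetric_def UNe pair_dist_def
    using F bF bU final_segment_bar[OF bar F(1)] bar_set_bar_set[OF bar, of F]
      conc_UNIV_left[OF F(1)] conc_UNIV_right[OF F(1)]
      conc_UNIV_left[OF final_segment_bar[OF bar F(1)]] conc_UNIV_right[OF final_segment_bar[OF bar F(1)]]
    by (auto simp: conc_UNIV_left)
  have iso: "isometry UNIV (pair_dist bar F) G dG (g \<circ> ?f) \<longleftrightarrow>
      g x \<in> G \<and> g y \<in> G \<and> dG (g x) (g y) = F" if "vmetric bar G dG" for G :: "'r set" and dG g
  proof -
    have "dG (g p) (g p) = UNIV" if "g p \<in> G" for p
      using \<open>vmetric bar G dG\<close> that unfolding vmetric_def by blast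
    moreover have "dG (g y) (g x) = bar_set bar (dG (g x) (g y))" if "g x \<in> G" "g y \<in> G"
      using \<open>vmetric bar G dG\<close> that unfolding vmetric_def by blast
    ultimately show ?thesis
      unfolding isometry_def UNe pair_dist_def by auto
  qed
  show ?thesis
  proof (cases "injective_space bar E d")
    case True
    then have vm: "vmetric bar E d" by (simp add: injective_space_def)
    have isoE: "isometry UNIV (pair_dist bar F) E d ?f \<longleftrightarrow> x \<in> E \<and> y \<in> E \<and> d x y = F"
      using iso[OF vm, of id] by simp
    have "(isometry UNIV (pair_dist bar F) G dG (g \<circ> ?f) \<longleftrightarrow> isometry E d G dG g) \<longleftrightarrow>
        (dG (g x) (g y) = F \<longrightarrow> isometry E d G dG g)"
      if "x \<in> E" "y \<in> E" "d x y = F" "vmetric bar G dG" "nonexpansive E d G dG g"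
      for G :: "'q set" and dG g
      using that iso[OF that(4), of g] unfolding isometry_def[of E] nonexpansive_def by auto
    then show ?thesis
      unfolding pair_envelope_def injective_envelope_def isoE using vp True by blast
  qed (simp add: pair_envelope_def injective_envelope_def)
qed

section \<open>The points of the envelope as closed segments\<close>

locale pair_env =
  fixes bar :: "'a::order \<Rightarrow> 'a" and F :: "'a list set"
    and E :: "'p set" and d :: "'p \<Rightarrow> 'p \<Rightarrow> 'a list set" and x y :: 'p
  assumes bar: "order_involution bar" and F: "final_segment F" "F \<noteq> UNIV"
    and env: "pair_envelope bar F E d x y"
begin

lemma injective: "injective_space bar E d" and x_in [simp]: "x \<in> E" and y_in [simp]: "y \<in> E"
  and dist_xy: "d x y = F"
  using env unfolding pair_envelope_iff[OF bar F] by blast+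

lemma vmetric_env: "vmetric bar E d"
  using injective by (simp add: injective_space_def)

lemma final_dist: "p \<in> E \<Longrightarrow> q \<in> E \<Longrightarrow> final_segment (d p q)"
  using vmetric_env unfolding vmetric_def by blast

lemma dist_UNIV_iff: "p \<in> E \<Longrightarrow> q \<in> E \<Longrightarrow> d p q = UNIV \<longleftrightarrow> p = q"
  using vmetric_env unfolding vmetric_def by blast

lemma dist_self [simp]: "p \<in> E \<Longrightarrow> d p p = UNIV"
  using dist_UNIV_iff by blast

lemma Nil_in_dist_iff: "p \<in> E \<Longrightarrow> q \<in> E \<Longrightarrow> [] \<in> d p q \<longleftrightarrow> p = q"
  using dist_UNIV_iff final_segment_Nil_iff final_dist by blast

lemma dist_triangle:
  "p \<in> E \<Longrightarrow> q \<in> E \<Longrightarrow> r \<in> E \<Longrightarrow> u \<in> d p r \<Longrightarrow> v \<in> d r q \<Longrightarrow> u @ v \<in> d p q"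
  using vmetric_env unfolding vmetric_def conc_def by blast

lemma dist_sym: "p \<in> E \<Longrightarrow> q \<in> E \<Longrightarrow> bar_set bar (d q p) = d p q"
  using vmetric_env unfolding vmetric_def by blast

lemma bar_word_dist: "p \<in> E \<Longrightarrow> q \<in> E \<Longrightarrow> bar_word bar w \<in> d p q \<longleftrightarrow> w \<in> d q p"
  using dist_sym mem_bar_set_iff[OF bar] by blast

lemma x_neq_y: "x \<noteq> y"
  using dist_xy F(2) dist_self by force

text \<open>Hyperconvexity for two balls: the constraints \<open>X\<close> from \<open>p\<close> and
  \<open>bar_set bar Y\<close> from \<open>q\<close> are compatible, so
  \<open>injective_one_point\<close> yields a point meeting both.\<close>

lemma exists_between:
  assumes pq: "p \<in> E" "q \<in> E" and XY: "final_segment X" "final_segment Y" "conc X Y \<subseteq> d p q"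
  shows "\<exists>e\<in>E. X \<subseteq> d p e \<and> Y \<subseteq> d e q"
proof -
  have bb: "bar_set bar (bar_set bar Z) = Z" for Z by (rule bar_set_bar_set[OF bar])
  have "conc (bar_set bar Y) (bar_set bar X) \<subseteq> d q p"
    using bar_set_mono[OF XY(3), of bar] dist_sym[OF pq(2,1)] by (simp add: bar_set_conc)
  then have "\<exists>e\<in>E. \<forall>(a, r)\<in>{(p, X), (q, bar_set bar Y)}. r \<subseteq> d a e"
    using pq XY final_segment_bar[OF bar XY(2)]
    by (intro injective_one_point[OF bar injective]) (auto simp: bb)
  then obtain e where e: "e \<in> E" "X \<subseteq> d p e" "bar_set bar Y \<subseteq> d q e" by auto
  have "Y \<subseteq> d e q"
    using bar_set_mono[OF e(3), of bar] dist_sym[OF e(1) pq(2)] by (simp add: bb)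
  then show ?thesis using e by blast
qed

text \<open>Apply \<open>exists_between\<close> to the upward closures of \<open>u\<close> and
  \<open>v\<close>; their product stays in \<open>d p q\<close> because that set is final.\<close>

lemma exists_intermediate:
  assumes pq: "p \<in> E" "q \<in> E" and w: "u @ v \<in> d p q"
  shows "\<exists>e\<in>E. u \<in> d p e \<and> v \<in> d e q"
proof -
  let ?up = "\<lambda>u. {w. list_emb (\<le>) u w}"
  have up: "final_segment (?up u)" for u :: "'a list"
    unfolding final_segment_def higman_le_iff_list_emb
    by (blast intro: list_emb_trans order_trans)
  have "conc (?up u) (?up v) \<subseteq> d p q"
    using final_segmentD[OF final_dist[OF pq] w] list_emb_append_mono unfolding conc_def by blast
  moreover have "u \<in> ?up u" "v \<in> ?up v" by (simp_all add: list_emb_refl)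
  ultimately show ?thesis using exists_between[OF pq up up] by blast
qed

text \<open>Mapping a point \<open>e\<close> to the closure of \<open>d x e\<close> is nonexpansive into the
  space of final segments and isometric on \<open>{x, y}\<close>, hence isometric.\<close>

lemma dist_seg_closure:
  assumes "p \<in> E" "q \<in> E"
  shows "d p q = seg_dist bar (seg_closure F (d x p)) (seg_closure F (d x q))"
proof -
  let ?G = "{X :: 'a list set. final_segment X}" and ?g = "\<lambda>e. seg_closure F (d x e)"
  have res: "w \<in> residual (d x p) (d x q)" if "p \<in> E" "q \<in> E" "w \<in> d p q" for p q w
    using dist_triangle[OF x_in that(2,1) _ that(3)] by (simp add: residual_def)
  have ne: "nonexpansive E d ?G (seg_dist bar) ?g"
    unfolding nonexpansive_def
  proof (intro conjI ballI subsetI)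
    fix p q w assume pq: "p \<in> E" "q \<in> E" "w \<in> d p q"
    then have "bar_word bar w \<in> d q p" by (simp add: bar_word_dist)
    then show "w \<in> seg_dist bar (?g p) (?g q)"
      using pq res[OF pq] res[of q p] by (simp add: seg_dist_def mem_bar_set_iff[OF bar] residual_seg_closure)
  qed (auto simp: final_segment_seg_closure F)
  have "injective_envelope bar UNIV (pair_dist bar F) E d (case_endpoint x y)"
    using env by (simp add: pair_envelope_def)
  \<comment> \<open>The points of the target are sets of words, not elements of \<open>'p\<close>,
    hence the form of essentiality for arbitrary types.\<close>
  from injective_envelope_essential[OF this vmetric_seg_dist[OF bar] ne]
  have "isometry E d ?G (seg_dist bar) ?g \<longleftrightarrow>
    isometry UNIV (pair_dist bar F) ?G (seg_dist bar) (?g \<circ> case_endpoint x y)" by blast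
  moreover have "isometry UNIV (pair_dist bar F) ?G (seg_dist bar) (?g \<circ> case_endpoint x y)"
  proof -
    have gx: "?g x = UNIV" by (simp add: seg_closure_UNIV)
    have gy: "?g y = F" by (simp add: dist_xy seg_closure_self F)
    have "seg_dist bar UNIV F = F"
      using seg_dist_antimono[OF bar] by (simp add: residual_UNIV F)
    moreover have "F \<in> ?G" "UNIV \<in> ?G" using F(1) by simp_all
    then have "seg_dist bar F UNIV = bar_set bar (seg_dist bar UNIV F)"
      and "seg_dist bar UNIV UNIV = UNIV" "seg_dist bar F F = UNIV"
      using vmetric_seg_dist[OF bar] unfolding vmetric_def by blast+
    moreover have "seg_dist bar (?g (case_endpoint x y p)) (?g (case_endpoint x y q)) =
        pair_dist bar F p q" for p q
      using calculation gx gy by (cases p; cases q) (simp_all add: pair_dist_def)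
    moreover have "?g (case_endpoint x y p) \<in> ?G" for p
      using gx gy F(1) by (cases p) simp_all
    ultimately show ?thesis
      unfolding isometry_def by auto
  qed
  ultimately show ?thesis using assms unfolding isometry_def by simp
qed

text \<open>Injectivity places a point with \<open>X\<close> before it and
  \<open>residual X F\<close> after it; the triangle inequality through it then bounds
  \<open>d x e\<close> by the closure of \<open>X\<close>.\<close>

lemma exists_point:
  assumes "final_segment X" "seg_closure F X = X"
  shows "\<exists>e\<in>E. d x e = X"
proof -
  have "conc X (residual X F) \<subseteq> d x y"
    by (auto simp: dist_xy conc_def residual_def)
  then obtain e where e: "e \<in> E" "X \<subseteq> d x e" "residual X F \<subseteq> d e y"
    using exists_between[OF x_in y_in assms(1) final_segment_residual[OF F(1)]] by blast
  have "w \<in> seg_closure F X" if "w \<in> d x e" for w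
    using dist_triangle[OF x_in y_in e(1) that] e(3) dist_xy
    by (auto simp: seg_closure_def left_residual_def)
  then show ?thesis using e assms(2) by blast
qed

text \<open>A point that realizes the closure of \<open>d x e\<close> has the same closure as
  \<open>e\<close>, so its distance from \<open>e\<close> is \<open>UNIV\<close>.\<close>

lemma dist_x_closed:
  assumes "e \<in> E" shows "seg_closure F (d x e) = d x e"
proof -
  obtain e' where e': "e' \<in> E" "d x e' = seg_closure F (d x e)"
    using exists_point[OF final_segment_seg_closure[OF F(1)] seg_closure_idem] by blast
  have "d e e' = d e' e'"
    using dist_seg_closure[OF assms e'(1)] dist_seg_closure[OF e'(1) e'(1)] e'(2)
    by (simp add: seg_closure_idem)
  then have "e = e'" using dist_UNIV_iff assms e'(1) by force
  then show ?thesis using e'(2) by simp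
qed

lemma dist_eq:
  assumes "p \<in> E" "q \<in> E" shows "d p q = seg_dist bar (d x p) (d x q)"
  using dist_seg_closure[OF assms] unfolding assms[THEN dist_x_closed] .

lemma dist_x_inj:
  assumes "p \<in> E" "q \<in> E" "d x p = d x q" shows "p = q"
  using dist_eq[OF assms(1,2)] dist_eq[OF assms(2,2)] dist_UNIV_iff[OF assms(1,2)] assms
  by (metis dist_self)

text \<open>Together with \<open>dist_eq\<close> this describes the envelope in terms of
  \<open>F\<close> alone, whence its uniqueness.\<close>

lemma dist_x_bij: "bij_betw (d x) E {X. final_segment X \<and> seg_closure F X = X}"
  unfolding bij_betw_def inj_on_def
  using dist_x_inj exists_point dist_x_closed final_dist[OF x_in] by blast

lemma dist_antimono:
  assumes "p \<in> E" "q \<in> E" "d x q \<subseteq> d x p" shows "d p q = residual (d x p) (d x q)"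
  using seg_dist_antimono[OF bar final_dist[OF x_in assms(1)] assms(3)]
  unfolding dist_eq[OF assms(1,2)] .

lemma F_subset_dist_x:
  assumes "e \<in> E" shows "F \<subseteq> d x e"
proof -
  have "F \<subseteq> seg_closure F (d x e)"
    using final_segment_append_right[OF F(1)] by (auto simp: seg_closure_def left_residual_def)
  then show ?thesis using dist_x_closed[OF assms] by simp
qed

lemma dist_y:
  assumes "e \<in> E" shows "d e y = residual (d x e) F"
  using dist_antimono[OF assms y_in] F_subset_dist_x[OF assms] unfolding dist_xy .

lemma dist_x_eq:
  assumes "e \<in> E" shows "d x e = left_residual F (d e y)"
  using dist_x_closed[OF assms] unfolding dist_y[OF assms] seg_closure_def by (rule sym)

lemma dist_y_inj:
  assumes "p \<in> E" "q \<in> E" "d p y = d q y" shows "p = q"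
  using dist_x_inj[OF assms(1,2)] dist_x_eq[OF assms(1)] dist_x_eq[OF assms(2)] assms(3) by simp

text \<open>Since \<open>d x q\<close> is the left residual of \<open>F\<close> by
  \<open>d q y\<close>, whether \<open>w\<close> carries \<open>d x p\<close> into
  \<open>d x q\<close> can be tested in \<open>F\<close> after continuing to \<open>y\<close>. The
  barred word covers the reverse direction.\<close>

lemma mem_distI:
  assumes pq: "p \<in> E" "q \<in> E"
    and uv: "\<And>u v. u \<in> d x p \<Longrightarrow> v \<in> d q y \<Longrightarrow> u @ w @ v \<in> F"
    and vu: "\<And>u v. u \<in> d x q \<Longrightarrow> v \<in> d p y \<Longrightarrow> u @ bar_word bar w @ v \<in> F"
  shows "w \<in> d p q"
proof -
  have "u @ w \<in> d x q" if "u \<in> d x p" for u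
    unfolding dist_x_eq[OF pq(2)] left_residual_def using uv[OF that] by simp
  moreover have "u @ bar_word bar w \<in> d x p" if "u \<in> d x q" for u
    unfolding dist_x_eq[OF pq(1)] left_residual_def using vu[OF that] by simp
  ultimately show ?thesis
    unfolding dist_eq[OF pq] seg_dist_def residual_def by (simp add: mem_bar_set_iff[OF bar])
qed

text \<open>\<open>exists_intermediate\<close> supplies the vertex after the first letter;
  conversely, labels along a path concatenate by the triangle inequality.\<close>

lemma path_label_iff:
  assumes "p \<in> E" "q \<in> E"
  shows "path_label (space_trans E d) p w q \<longleftrightarrow> w \<in> d p q"
  using assms
proof (induction w arbitrary: p)
  case Nil
  then show ?case by (simp add: Nil_in_dist_iff)
next
  case (Cons a w)
  have "(\<exists>r\<in>E. [a] \<in> d p r \<and> w \<in> d r q) \<longleftrightarrow> [a] @ w \<in> d p q"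
    using exists_intermediate[OF Cons.prems, of "[a]" w] dist_triangle[OF Cons.prems] by blast
  then show ?case using Cons by (auto simp: space_trans_def)
qed

lemma accepted_eq: "accepted (mk_automaton E (space_trans E d) {x} {y}) = F"
  by (auto simp: accepted_def mk_automaton_def path_label_iff dist_xy)

section \<open>The graph and the factorization of distances at a separating point\<close>

abbreviation "graph \<equiv> trans_graph (space_trans E d)"

lemma graph_iff: "(p, q) \<in> graph \<longleftrightarrow> p \<in> E \<and> q \<in> E \<and> (\<exists>a. [a] \<in> d p q)"
proof -
  have "[bar a] \<in> d p q" if "p \<in> E" "q \<in> E" "[a] \<in> d q p" for a
    using bar_word_dist[OF that(1,2), of "[a]"] that(3) by (simp add: bar_word_def)
  then show ?thesis unfolding trans_graph_def space_trans_def by auto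
qed

lemma sym_graph: "sym graph"
  by (auto simp: sym_def trans_graph_def)

text \<open>Induction along a path labelled \<open>w\<close>: edges from \<open>S - {z}\<close> stay
  in \<open>S\<close>, so a path that ends outside \<open>S\<close> or at \<open>z\<close> must
  visit \<open>z\<close>.\<close>

lemma dist_through:
  assumes S: "graph `` (S - {z}) \<subseteq> S"
    and "z \<in> E" "p \<in> E" "q \<in> E" "p \<in> S" "q \<notin> S \<or> q = z" "w \<in> d p q"
  shows "w \<in> conc (d p z) (d z q)"
  using assms(3,5,7)
proof (induction w arbitrary: p)
  case Nil
  then have "p = z" using Nil_in_dist_iff assms(4,6) by blast
  then show ?case using Nil(3) conc_UNIV_left[OF final_dist] assms(2,4) by simp
next
  case (Cons a w)
  show ?case
  proof (cases "p = z")
    case True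
    then show ?thesis using Cons.prems(3) conc_UNIV_left[OF final_dist] assms(2,4) by simp
  next
    case False
    obtain r where r: "r \<in> E" "[a] \<in> d p r" "w \<in> d r q"
      using exists_intermediate[OF Cons.prems(1) assms(4), of "[a]" w] Cons.prems(3) by auto
    have "r \<in> S" using S False graph_iff r Cons.prems(1,2) by blast
    then have "w \<in> conc (d r z) (d z q)" using Cons.IH r by blast
    then obtain u v where uv: "w = u @ v" "u \<in> d r z" "v \<in> d z q" by (auto simp: conc_def)
    have "[a] @ u \<in> d p z" using dist_triangle[OF Cons.prems(1) assms(2) r(1,2) uv(2)] .
    moreover have "a # w = ([a] @ u) @ v" using uv(1) by simp
    ultimately show ?thesis using uv(3) unfolding conc_def by blast
  qed
qed

lemma dist_through_eq:
  assumes "graph `` (S - {z}) \<subseteq> S"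
    and "z \<in> E" "p \<in> E" "q \<in> E" "p \<in> S" "q \<notin> S \<or> q = z"
  shows "d p q = conc (d p z) (d z q)" "d q p = conc (d q z) (d z p)"
proof -
  show "d p q = conc (d p z) (d z q)"
    using dist_through[OF assms] dist_triangle[OF assms(3,4,2)] by (auto simp: conc_def)
  then have "bar_set bar (d p q) = bar_set bar (conc (d p z) (d z q))" by simp
  then show "d q p = conc (d q z) (d z p)"
    using assms(2-4) by (simp add: bar_set_conc dist_sym)
qed

end

section \<open>Connectedness and cut vertices\<close>

lemma equiv_reachable_in: "sym R \<Longrightarrow> equiv V (reachable_in V R)"
  unfolding equiv_def refl_on_def
proof (intro conjI)
  assume "sym R"
  then have "sym ((R \<inter> V \<times> V)\<^sup>*)" by (auto simp: sym_def intro!: symD[OF sym_rtrancl])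
  then show "sym (reachable_in V R)" by (auto simp: reachable_in_def sym_def)
  show "Relation.trans (reachable_in V R)"
    unfolding Relation.trans_def reachable_in_def by (blast intro: rtrancl_trans)
qed (auto simp: reachable_in_def)

lemma reachable_in_step:
  "(u, v) \<in> reachable_in V R \<Longrightarrow> (v, w) \<in> R \<Longrightarrow> w \<in> V \<Longrightarrow> (u, w) \<in> reachable_in V R"
  by (auto simp: reachable_in_def intro: rtrancl_into_rtrancl)

lemma reachable_in_closed:
  assumes "(u, v) \<in> reachable_in V R" "u \<in> A"
    and "\<And>s t. s \<in> A \<Longrightarrow> t \<in> V \<Longrightarrow> (s, t) \<in> R \<Longrightarrow> t \<in> A"
  shows "v \<in> A"
proof -
  have "(u, v) \<in> (R \<inter> V \<times> V)\<^sup>*" using assms(1) by (simp add: reachable_in_def)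
  then show ?thesis by (induction rule: rtrancl_induct) (use assms(2,3) in auto)
qed

lemma connected_graph_closed:
  assumes "connected_graph V R" "A \<subseteq> V" "A \<noteq> {}"
    and "\<And>s t. s \<in> A \<Longrightarrow> t \<in> V \<Longrightarrow> (s, t) \<in> R \<Longrightarrow> t \<in> A"
  shows "A = V"
proof -
  obtain C where C: "V // reachable_in V R = {C}"
    using assms(1) by (auto simp: connected_graph_def components_def)
  obtain a where a: "a \<in> A" using assms(3) by blast
  have "b \<in> A" if "b \<in> V" for b
  proof -
    have "reachable_in V R `` {a} = reachable_in V R `` {b}"
      using quotientI[of a V "reachable_in V R"] quotientI[of b V "reachable_in V R"] a that assms(2)
      unfolding C by auto
    moreover have "(b, b) \<in> reachable_in V R" using that by (simp add: reachable_in_def)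
    ultimately have "(a, b) \<in> reachable_in V R" by auto
    then show ?thesis using a assms(4) by (rule reachable_in_closed)
  qed
  then show ?thesis using assms(2) by blast
qed

lemma connected_graphI:
  assumes "V \<noteq> {}" "\<And>u v. u \<in> V \<Longrightarrow> v \<in> V \<Longrightarrow> (u, v) \<in> reachable_in V R"
  shows "connected_graph V R"
proof -
  have "reachable_in V R `` {u} = V" if "u \<in> V" for u
    using assms(2) that by (auto simp: reachable_in_def)
  then have "V // reachable_in V R = {V}"
    using assms(1) by (auto simp: quotient_def)
  then show ?thesis by (simp add: connected_graph_def components_def)
qed

text \<open>One component embeds into the nonempty set of components without \<open>z\<close>.
  Equinumerosity would make the graph without \<open>z\<close> connected, and then \<open>A\<close>
  would be all of it.\<close>

lemma cut_vertexI:
  assumes conn: "connected_graph V R" and z: "z \<in> V" and A: "A \<subseteq> V - {z}" "A \<noteq> {}" "A \<noteq> V - {z}"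
    and closed: "\<And>s t. s \<in> A \<Longrightarrow> t \<in> V - {z} \<Longrightarrow> (s, t) \<in> R \<Longrightarrow> t \<in> A"
  shows "cut_vertex V R z"
proof -
  obtain C where C: "components V R = {C}" using conn by (auto simp: connected_graph_def)
  obtain D where D: "D \<in> components (V - {z}) R"
    using A by (auto simp: components_def intro: quotientI)
  then have "{C} \<lesssim> components (V - {z}) R"
    by (auto simp: lepoll_def intro!: exI[of _ "\<lambda>_. D"])
  moreover have "\<not> {C} \<approx> components (V - {z}) R"
  proof
    assume "{C} \<approx> components (V - {z}) R"
    then have "\<exists>D. components (V - {z}) R = {D}"
      by (auto simp: eqpoll_def bij_betw_def)
    then have "connected_graph (V - {z}) R" by (simp add: connected_graph_def)
    then have "A = V - {z}" using A(1,2) closed by (rule connected_graph_closed)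
    then show False using A(3) by simp
  qed
  ultimately show ?thesis using z C by (simp add: cut_vertex_def lesspoll_def)
qed

text \<open>Inclusion rather than equality, because nothing may be left after the deletion.\<close>

lemma not_cut_vertex_subset_singleton:
  assumes "components (V - {v}) R \<subseteq> {D}" shows "\<not> cut_vertex V R v"
proof
  assume cut: "cut_vertex V R v"
  then obtain C where C: "C \<in> components V R"
    by (auto simp: cut_vertex_def components_def intro: quotientI)
  then have "components (V - {v}) R \<lesssim> components V R"
    using assms by (auto simp: lepoll_def inj_on_def intro!: exI[of _ "\<lambda>_. C"])
  then show False using cut lepoll_antisym by (auto simp: cut_vertex_def lesspoll_def)
qed

lemma reachable_in_cong:
  "R \<inter> V \<times> V = R' \<inter> V \<times> V \<Longrightarrow> reachable_in V R = reachable_in V R'"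
  by (simp add: reachable_in_def)

lemma cut_vertex_cong:
  assumes "R \<inter> V \<times> V = R' \<inter> V \<times> V" shows "cut_vertex V R z \<longleftrightarrow> cut_vertex V R' z"
proof -
  have "R \<inter> (V - {z}) \<times> (V - {z}) = R' \<inter> (V - {z}) \<times> (V - {z})" using assms by blast
  then show ?thesis
    using reachable_in_cong[OF assms] reachable_in_cong[of R "V - {z}" R']
    by (simp add: cut_vertex_def components_def)
qed

lemma connected_graph_cong:
  "R \<inter> V \<times> V = R' \<inter> V \<times> V \<Longrightarrow> connected_graph V R = connected_graph V R'"
  by (simp add: connected_graph_def components_def reachable_in_cong[of R V R'])

section \<open>Cut vertices in the graph of the envelope\<close>

context pair_env
begin

text \<open>A word of \<open>F\<close> leads from \<open>x\<close> to every point, so its bar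
  followed by itself leads from \<open>p\<close> back to \<open>x\<close> and on to
  \<open>q\<close>.\<close>

lemma dist_nonempty:
  assumes "F \<noteq> {}" "p \<in> E" "q \<in> E" shows "d p q \<noteq> {}"
proof -
  obtain w where "w \<in> F" using assms(1) by blast
  then have "w \<in> d x p" "w \<in> d x q" using F_subset_dist_x assms(2,3) by blast+
  then have "bar_word bar w @ w \<in> d p q"
    using dist_triangle[OF assms(2,3) x_in] bar_word_dist[OF assms(2) x_in] by blast
  then show ?thesis by blast
qed

lemma dist_reachable: "p \<in> E \<Longrightarrow> q \<in> E \<Longrightarrow> w \<in> d p q \<Longrightarrow> (p, q) \<in> reachable_in E graph"
proof (induction w arbitrary: p)
  case Nil
  then show ?case using Nil_in_dist_iff by (auto simp: reachable_in_def)
next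
  case (Cons a w)
  then obtain r where r: "r \<in> E" "[a] \<in> d p r" "w \<in> d r q"
    using exists_intermediate[OF Cons.prems(1,2), of "[a]" w] by auto
  then have "(p, r) \<in> graph \<inter> E \<times> E" using Cons.prems by (auto simp: graph_iff)
  then show ?case
    using Cons.IH[OF r(1) Cons.prems(2) r(3)] by (auto simp: reachable_in_def intro: converse_rtrancl_into_rtrancl)
qed

lemma connected_graph:
  assumes "F \<noteq> {}" shows "connected_graph E graph"
  using dist_nonempty[OF assms] dist_reachable by (intro connected_graphI) (use x_in in blast)+

text \<open>Provides the set required by \<open>dist_through\<close>: a component of the graph
  without \<open>v\<close>, with \<open>v\<close> added.\<close>

lemma reachable_closed:
  fixes v e
  defines "S \<equiv> insert v (reachable_in (E - {v}) graph `` {e})"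
  shows "graph `` (S - {v}) \<subseteq> S"
proof
  fix t assume "t \<in> graph `` (S - {v})"
  then obtain s where st: "s \<in> S" "s \<noteq> v" "(s, t) \<in> graph" by blast
  show "t \<in> S"
  proof (cases "t = v")
    case False
    then have "t \<in> E - {v}" using st(3) by (simp add: graph_iff)
    then show ?thesis using reachable_in_step[of e s] st by (auto simp: S_def)
  qed (simp add: S_def)
qed

text \<open>A component of the graph without \<open>v\<close> that contained neither \<open>x\<close> nor \<open>y\<close> would
  consist of points \<open>e\<close> with \<open>d x e \<subseteq> d x v\<close> and \<open>d e y \<subseteq> d v y\<close>, that is, \<open>e = v\<close>.\<close>

lemma reachable_x_or_y:
  assumes v: "v \<in> E" and e: "e \<in> E - {v}"
  shows "(e, x) \<in> reachable_in (E - {v}) graph \<or> (e, y) \<in> reachable_in (E - {v}) graph"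
proof (rule ccontr)
  assume neg: "\<not> ?thesis"
  let ?S = "insert v (reachable_in (E - {v}) graph `` {e})"
  have S: "graph `` (?S - {v}) \<subseteq> ?S" by (rule reachable_closed)
  have eS: "e \<in> ?S" using e by (auto simp: reachable_in_def)
  have "e \<in> E" "x \<notin> ?S \<or> x = v" "y \<notin> ?S \<or> y = v" using neg e by auto
  then have "d x e = conc (d x v) (d v e)" "d e y = conc (d e v) (d v y)"
    using dist_through_eq(2)[OF S v _ x_in eS] dist_through_eq(1)[OF S v _ y_in eS] by blast+
  then have sub: "d x e \<subseteq> d x v" "d e y \<subseteq> d v y"
    using final_segment_append_right[OF final_dist[OF x_in v]]
      final_segment_append_left[OF final_dist[OF v y_in]] by (auto simp: conc_def)
  \<comment> \<open>Residuals reverse the inclusion \<open>d x e \<subseteq> d x v\<close>.\<close>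
  then have "d v y \<subseteq> d e y"
    using dist_y v e by (auto simp: residual_def)
  then show False using sub(2) dist_y_inj[of e v] v e by blast
qed

text \<open>Deleting \<open>v\<close> leaves at most the components of \<open>x\<close> and of
  \<open>y\<close>. For a cut vertex both must exist and differ, so all paths from \<open>x\<close>
  to \<open>y\<close> pass \<open>v\<close>.\<close>

lemma cut_vertex_factorization:
  assumes "cut_vertex E graph v" shows "v \<in> E - {x, y} \<and> F = conc (d x v) (d v y)"
proof -
  have v: "v \<in> E" using assms by (simp add: cut_vertex_def)
  let ?r = "reachable_in (E - {v}) graph"
  have eq: "equiv (E - {v}) ?r" using equiv_reachable_in[OF sym_graph] .
  have class_eq: "?r `` {e} = ?r `` {p} \<and> p \<noteq> v" if "(e, p) \<in> ?r" for e p
    using equiv_class_eq[OF eq that] that unfolding reachable_in_def by blast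
  have class_xy: "?r `` {e} = ?r `` {x} \<and> x \<noteq> v \<or> ?r `` {e} = ?r `` {y} \<and> y \<noteq> v"
    if "e \<in> E - {v}" for e
    using reachable_x_or_y[OF v that] class_eq by blast
  have no: "\<not> components (E - {v}) graph \<subseteq> {D}" for D
    using not_cut_vertex_subset_singleton assms by metis
  have comp: "D = ?r `` {x} \<and> x \<noteq> v \<or> D = ?r `` {y} \<and> y \<noteq> v"
    if D: "D \<in> components (E - {v}) graph" for D
  proof -
    obtain e where "e \<in> E - {v}" "D = ?r `` {e}"
      using D unfolding components_def by (blast elim: quotientE)
    then show ?thesis using class_xy[of e] by simp
  qed
  \<comment> \<open>Under each of these conditions at most one component is left, which
    \<open>no\<close> forbids.\<close>
  have sub: "components (E - {v}) graph \<subseteq> {?r `` {x}}" if "v = y \<or> ?r `` {x} = ?r `` {y}"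
    using that comp by blast
  have sub': "components (E - {v}) graph \<subseteq> {?r `` {y}}" if "v = x"
    using that comp by blast
  have ne: "v \<noteq> x" "v \<noteq> y" "?r `` {x} \<noteq> ?r `` {y}" using sub sub' no by blast+
  then have nr: "(x, y) \<notin> ?r" using equiv_class_eq[OF eq] by blast
  let ?S = "insert v (?r `` {x})"
  have S: "graph `` (?S - {v}) \<subseteq> ?S" by (rule reachable_closed)
  have "x \<in> ?S" using ne by (simp add: reachable_in_def)
  then have "d x y = conc (d x v) (d v y)"
    using dist_through_eq(1)[OF S v x_in y_in] nr ne by blast
  then show ?thesis using ne v dist_xy by simp
qed

text \<open>A trivial factorization would identify \<open>v\<close> with an endpoint:
  \<open>F = d x v\<close> gives \<open>v = y\<close>, and \<open>F = d v y\<close> gives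
  \<open>v = x\<close>.\<close>

lemma reducible_of_cut_vertex:
  assumes "cut_vertex E graph v" shows "\<not> irreducible_segment F"
proof
  note v = cut_vertex_factorization[OF assms]
  assume "irreducible_segment F"
  then have "F = d x v \<or> F = d v y"
    using v final_dist[OF x_in, of v] final_dist[OF _ y_in, of v] unfolding irreducible_segment_def by blast
  then show False
    using v dist_x_inj[of v y] dist_y_inj[of v x] dist_xy by auto
qed

subsection \<open>Points through which all paths pass\<close>

text \<open>The endpoints \<open>x\<close> and \<open>y\<close> qualify too, so that a chain of such
  points can run from one to the other.\<close>

definition splits :: "'p \<Rightarrow> bool" where
  "splits v \<longleftrightarrow> v \<in> E \<and> F = conc (d x v) (d v y)"

text \<open>By cancellation \<open>P\<close> and \<open>S\<close> are each other's residuals into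
  \<open>F\<close>; hence \<open>P\<close> is closed and belongs to a point.
  \<open>F \<noteq> {}\<close> keeps both factors nonempty, as cancellation requires.\<close>

lemma exists_split:
  assumes "final_segment P" "final_segment S" "F = conc P S" "F \<noteq> {}"
  obtains v where "splits v" "d x v = P" "d v y = S"
proof -
  have ne: "P \<noteq> {}" "S \<noteq> {}" using assms(3,4) by (auto simp: conc_empty_iff)
  have res: "residual P F = S" using residual_conc[OF assms(2) ne(1)] assms(3) by simp
  then have "seg_closure F P = P"
    using left_residual_conc[OF assms(1) ne(2)] assms(3) by (simp add: seg_closure_def)
  then obtain v where v: "v \<in> E" "d x v = P" using exists_point assms(1) by blast
  then have "d v y = S" using dist_y res by simp
  then show ?thesis using that v assms(3) unfolding splits_def by blast
qed

lemma splits_in: "splits v \<Longrightarrow> v \<in> E"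
  by (simp add: splits_def)

text \<open>The cut between \<open>u\<close> and \<open>w\<close> is compared with a cut
  \<open>p @ s\<close> witnessing the product: either \<open>s\<close> is a suffix of
  \<open>w\<close> or \<open>p\<close> is a prefix of \<open>u\<close>.\<close>

lemma splits_append:
  assumes "splits v" "u @ w \<in> F" obtains "u \<in> d x v" | "w \<in> d v y"
proof -
  obtain p s where ps: "u @ w = p @ s" "p \<in> d x v" "s \<in> d v y"
    using assms by (auto simp: splits_def conc_def)
  show ?thesis
  proof (cases "length u \<le> length p")
    case True
    then obtain t where "w = t @ s" using append_eq_append_suffix[OF ps(1)] by blast
    then show ?thesis
      using that(2) final_segment_append_left[OF final_dist[OF _ y_in] ps(3)] assms(1) splits_in by blast
  next
    case False
    then have "length w \<le> length s" using arg_cong[OF ps(1), of length] by simp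
    then obtain t where "u = p @ t" using append_eq_append_prefix[OF ps(1)] by blast
    then show ?thesis
      using that(1) final_segment_append_right[OF final_dist[OF x_in] ps(2)] assms(1) splits_in by blast
  qed
qed

lemma dist_x_subset_iff:
  assumes "p \<in> E" "q \<in> E" shows "d x p \<subseteq> d x q \<longleftrightarrow> d q y \<subseteq> d p y"
proof
  show "d x p \<subseteq> d x q \<Longrightarrow> d q y \<subseteq> d p y"
    using dist_y assms by (auto simp: residual_def)
  show "d q y \<subseteq> d p y \<Longrightarrow> d x p \<subseteq> d x q"
    unfolding dist_x_eq[OF assms(1)] dist_x_eq[OF assms(2)] by (auto simp: left_residual_def)
qed

text \<open>One word of \<open>d x e\<close> outside \<open>d x v\<close> forces, by
  \<open>splits_append\<close>, all of \<open>d e y\<close> into \<open>d v y\<close>.\<close>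

lemma splits_comparable:
  assumes "splits v" "e \<in> E" shows "d x v \<subseteq> d x e \<or> d x e \<subseteq> d x v"
proof (rule disjCI)
  assume "\<not> d x e \<subseteq> d x v"
  then obtain u where u: "u \<in> d x e" "u \<notin> d x v" by blast
  have "w \<in> d v y" if "w \<in> d e y" for w
    using splits_append[OF assms(1), of u w] dist_triangle[OF x_in y_in assms(2) u(1) that] u(2) dist_xy
    by blast
  then show "d x v \<subseteq> d x e" using dist_x_subset_iff assms splits_in by blast
qed

text \<open>For an edge labelled \<open>a\<close>, choose \<open>u\<close> in \<open>d x p\<close>
  outside \<open>d x v\<close> and \<open>w\<close> in \<open>d q y\<close> outside
  \<open>d v y\<close>. No cut of \<open>u @ [a] @ w\<close> can witness membership in
  \<open>F\<close>, because one letter cannot be divided.\<close>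

lemma splits_no_edge:
  assumes v: "splits v" and pq: "d x v \<subset> d x p" "d x q \<subset> d x v"
  shows "(p, q) \<notin> graph"
proof
  assume "(p, q) \<in> graph"
  then obtain a where a: "p \<in> E" "q \<in> E" "[a] \<in> d p q" by (auto simp: graph_iff)
  obtain u where u: "u \<in> d x p" "u \<notin> d x v" using pq(1) by blast
  have "\<not> d q y \<subseteq> d v y" using dist_x_subset_iff[OF splits_in[OF v] a(2)] pq(2) by blast
  then obtain w where w: "w \<in> d q y" "w \<notin> d v y" by blast
  have "u @ [a] @ w \<in> F"
    using dist_triangle[OF x_in y_in a(1) u(1)] dist_triangle[OF a(1) y_in a(2) a(3) w(1)] dist_xy by blast
  then obtain p' s where ps: "u @ [a] @ w = p' @ s" "p' \<in> d x v" "s \<in> d v y"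
    using v by (auto simp: splits_def conc_def)
  show False
  proof (cases "length p' \<le> length u")
    case True
    then have "length ([a] @ w) \<le> length s" using arg_cong[OF ps(1), of length] by simp
    then obtain t where "u = p' @ t" using append_eq_append_prefix[OF ps(1)] by blast
    then show False
      using u(2) final_segment_append_right[OF final_dist[OF x_in splits_in[OF v]] ps(2)] by blast
  next
    case False
    then have "length (u @ [a]) \<le> length p'" by simp
    moreover have "(u @ [a]) @ w = p' @ s" using ps(1) by simp
    ultimately obtain t where "w = t @ s" using append_eq_append_suffix by blast
    then show False
      using w(2) final_segment_append_left[OF final_dist[OF splits_in[OF v] y_in] ps(3)] by blast
  qed
qed

lemma splits_closed:
  assumes "splits v" "s \<in> E" "d x v \<subseteq> d x s" "s \<noteq> v" "(s, t) \<in> graph"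
  shows "d x v \<subseteq> d x t"
proof -
  have "t \<in> E" using assms(5) by (simp add: graph_iff)
  moreover have "d x v \<subset> d x s" using assms dist_x_inj splits_in by blast
  ultimately show ?thesis
    using splits_comparable[OF assms(1)] splits_no_edge[OF assms(1)] assms(5) by blast
qed

text \<open>By \<open>splits_closed\<close> the points \<open>e\<close> with
  \<open>d x v \<subseteq> d x e\<close> form a set that can be left only at \<open>v\<close>, as
  \<open>dist_through_eq\<close> requires.\<close>

lemma splits_dist:
  assumes v: "splits v" and pq: "p \<in> E" "q \<in> E" "d x v \<subseteq> d x p" "d x q \<subseteq> d x v"
  shows "d p q = conc (d p v) (d v q)" "d q p = conc (d q v) (d v p)"
proof -
  let ?S = "{e \<in> E. d x v \<subseteq> d x e}"
  have "graph `` (?S - {v}) \<subseteq> ?S"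
    using splits_closed[OF v] graph_iff by blast
  note * = dist_through_eq[OF this splits_in[OF v]]
  have "q \<notin> ?S \<or> q = v" using dist_x_inj[OF pq(2) splits_in[OF v]] pq(4) by blast
  then show "d p q = conc (d p v) (d v q)" "d q p = conc (d q v) (d v p)"
    using *[of p q] pq by blast+
qed

text \<open>The point of a nontrivial factorization cuts the space into the points on the side of
  \<open>x\<close> and those on the side of \<open>y\<close>, glued at \<open>v\<close>.\<close>

lemma reducible_space_of_reducible:
  assumes "\<not> irreducible_segment F" shows "\<not> irreducible_space E d"
proof -
  obtain P S where PS: "final_segment P" "final_segment S" "F = conc P S" "F \<noteq> P" "F \<noteq> S"
    using assms F unfolding irreducible_segment_def by blast
  then have "F \<noteq> {}" using conc_empty_iff by metis
  then obtain v where v: "splits v" "d x v = P" "d v y = S"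
    using exists_split PS by blast
  let ?U = "{e \<in> E. d x v \<subseteq> d x e}" and ?L = "{e \<in> E. d x e \<subseteq> d x v}"
  have vE: "v \<in> E" using splits_in[OF v(1)] .
  have UL: "e \<in> ?U \<or> e \<in> ?L" if "e \<in> E" for e
    using splits_comparable[OF v(1) that] that by blast
  have int: "?U \<inter> ?L = {v}" using dist_x_inj vE by blast
  have "is_product E d ?U ?L"
    unfolding is_product_def
  proof (intro conjI exI ballI)
    show "E = ?U \<union> ?L" using UL by blast
    fix p q assume pq: "p \<in> E" "q \<in> E"
    show "d p q = glued_dist ?U d ?L d v p q"
      using UL[OF pq(1)] UL[OF pq(2)] splits_dist[OF v(1) pq(1,2)] splits_dist[OF v(1) pq(2,1)]
      unfolding glued_dist_def by auto
  qed (fact int)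
  \<comment> \<open>Both parts are proper: \<open>y\<close> in \<open>?U\<close> would give
    \<open>P = F\<close>, and \<open>x\<close> in \<open>?L\<close> would give \<open>v = x\<close>
    and \<open>S = F\<close>.\<close>
  moreover have "y \<notin> ?U"
    using PS(4) v(2) F_subset_dist_x[OF vE] dist_xy by auto
  moreover have "x \<notin> ?L"
  proof
    assume "x \<in> ?L"
    then have "d v x = UNIV" using dist_UNIV_iff[OF x_in vE] dist_UNIV_iff[OF vE x_in] by auto
    then show False using v(3) PS(5) dist_xy dist_UNIV_iff[OF vE x_in] by simp
  qed
  ultimately show ?thesis unfolding irreducible_space_def using x_in y_in by blast
qed

text \<open>Residuals into the empty set are only \<open>{}\<close> and \<open>UNIV\<close>. This
  case is separate because \<open>connected_graph\<close> needs a word of \<open>F\<close>.\<close>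

lemma two_points_if_empty:
  assumes "F = {}" "e \<in> E" shows "e = x \<or> e = y"
proof (cases "d x e = {}")
  case True
  then show ?thesis using dist_x_inj[OF assms(2) y_in] dist_xy assms(1) by simp
next
  case False
  then have "d e y = {}" using dist_y[OF assms(2)] assms(1) by (auto simp: residual_def)
  then show ?thesis using dist_y_inj[OF assms(2) x_in] dist_xy assms(1) by simp
qed

text \<open>The gluing point is the cut vertex: an edge between the two parts carries a one-letter
  word that factors at \<open>z\<close>, so one factor is \<open>[]\<close> and an end of the edge
  equals \<open>z\<close>.\<close>

lemma cut_vertex_of_reducible_space:
  assumes "\<not> irreducible_space E d" shows "\<exists>v. cut_vertex E graph v"
proof -
  obtain E1 E2 where prod: "is_product E d E1 E2" "E \<noteq> E1" "E \<noteq> E2"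
    using assms x_neq_y x_in y_in unfolding irreducible_space_def by blast
  then obtain z where U: "E = E1 \<union> E2" and z: "E1 \<inter> E2 = {z}"
    and dist: "\<forall>u\<in>E. \<forall>v\<in>E. d u v = glued_dist E1 d E2 d z u v"
    unfolding is_product_def by blast
  obtain p q where pq: "p \<in> E1 - E2" "q \<in> E2 - E1" using prod(2,3) U by blast
  have zE: "z \<in> E" using z U by blast
  \<comment> \<open>\<open>p\<close>, \<open>q\<close> and \<open>z\<close> are three distinct
    points.\<close>
  have "F \<noteq> {}"
  proof
    assume "F = {}"
    then have "E \<subseteq> {x, y}" using two_points_if_empty by blast
    then show False using pq z U by blast
  qed
  moreover have "t \<in> E1 - {z}" if st: "s \<in> E1 - {z}" "t \<in> E - {z}" "(s, t) \<in> graph" for s t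
  proof (rule ccontr)
    assume "t \<notin> E1 - {z}"
    then have t: "t \<in> E2" "t \<notin> E1" "t \<noteq> z" and s: "s \<in> E1" "s \<notin> E2" "s \<noteq> z"
      using st U z by blast+
    then have "d s t = glued_dist E1 d E2 d z s t" using dist U by blast
    also have "\<dots> = conc (d s z) (d z t)" using s t by (simp add: glued_dist_def)
    finally have "d s t = conc (d s z) (d z t)" .
    moreover obtain a where "[a] \<in> d s t" using st(3) graph_iff by blast
    ultimately obtain u w where "[a] = u @ w" "u \<in> d s z" "w \<in> d z t" by (auto simp: conc_def)
    then have "[] \<in> d s z \<or> [] \<in> d z t" by (auto simp: Cons_eq_append_conv)
    then show False using Nil_in_dist_iff zE s t U by blast
  qed
  moreover have "E1 - {z} \<subseteq> E - {z}" "E1 - {z} \<noteq> {}" "E1 - {z} \<noteq> E - {z}"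
    using pq z U by blast+
  ultimately have "cut_vertex E graph z"
    using cut_vertexI[OF connected_graph zE, of "E1 - {z}"] by blast
  then show ?thesis by blast
qed

text \<open>A cut vertex makes \<open>F\<close> reducible, this makes the space reducible, and this
  yields a cut vertex.\<close>

lemma irreducible_segment_iff_space: "irreducible_segment F \<longleftrightarrow> irreducible_space E d"
  and irreducible_space_iff_no_cut_vertex: "irreducible_space E d \<longleftrightarrow> (\<nexists>v. cut_vertex E graph v)"
  using reducible_of_cut_vertex reducible_space_of_reducible cut_vertex_of_reducible_space by blast+

end

section \<open>Intervals between splitting points\<close>

lemma vmetric_subset:
  assumes "vmetric bar E' d'" "C \<subseteq> E'" shows "vmetric bar C d'"
  unfolding vmetric_def
proof (intro conjI ballI)
  fix p q assume "p \<in> C" "q \<in> C"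
  then have pq: "p \<in> E'" "q \<in> E'" using assms(2) by blast+
  show "final_segment (d' p q)" "d' p q = UNIV \<longleftrightarrow> p = q" "d' p q = bar_set bar (d' q p)"
    using assms(1) pq unfolding vmetric_def by blast+
  show "conc (d' p r) (d' r q) \<subseteq> d' p q" if "r \<in> C" for r
    using assms pq that unfolding vmetric_def by blast
qed

context pair_env
begin

text \<open>Collapses the side of \<open>x\<close> to \<open>v\<close>. Distances across
  \<open>v\<close> factor through it, so moving one end to \<open>v\<close> only enlarges the set of
  words.\<close>

lemma splits_retract_upper:
  assumes v: "splits v"
  shows "nonexpansive E d E d (\<lambda>e. if d x v \<subseteq> d x e then v else e)"
  unfolding nonexpansive_def
proof (intro conjI ballI)
  note vE = splits_in[OF v]
  show "(\<lambda>e. if d x v \<subseteq> d x e then v else e) ` E \<subseteq> E" using vE by auto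
  fix p q assume pq: "p \<in> E" "q \<in> E"
  have up: "d p q \<subseteq> d v q" "d q p \<subseteq> d q v" if "d x v \<subseteq> d x p" "\<not> d x v \<subseteq> d x q" "p \<in> E" "q \<in> E" for p q
  proof -
    have "d x q \<subseteq> d x v" using splits_comparable[OF v that(4)] that(2) by blast
    then show "d p q \<subseteq> d v q" "d q p \<subseteq> d q v"
      using splits_dist[OF v that(3,4,1)] final_segment_append_left[OF final_dist[OF vE that(4)]]
        final_segment_append_right[OF final_dist[OF that(4) vE]] by (auto simp: conc_def)
  qed
  show "d p q \<subseteq> d (if d x v \<subseteq> d x p then v else p) (if d x v \<subseteq> d x q then v else q)"
    using up(1)[OF _ _ pq] up(2)[OF _ _ pq(2,1)] dist_self[OF vE] by simp
qed

lemma splits_retract_lower: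
  assumes v: "splits v"
  shows "nonexpansive E d E d (\<lambda>e. if d x e \<subseteq> d x v then v else e)"
  unfolding nonexpansive_def
proof (intro conjI ballI)
  note vE = splits_in[OF v]
  show "(\<lambda>e. if d x e \<subseteq> d x v then v else e) ` E \<subseteq> E" using vE by auto
  fix p q assume pq: "p \<in> E" "q \<in> E"
  have lo: "d p q \<subseteq> d p v" "d q p \<subseteq> d v p" if "d x q \<subseteq> d x v" "\<not> d x p \<subseteq> d x v" "p \<in> E" "q \<in> E" for p q
  proof -
    have "d x v \<subseteq> d x p" using splits_comparable[OF v that(3)] that(2) by blast
    then show "d p q \<subseteq> d p v" "d q p \<subseteq> d v p"
      using splits_dist[OF v that(3,4) _ that(1)] final_segment_append_left[OF final_dist[OF vE that(3)]]
        final_segment_append_right[OF final_dist[OF that(3) vE]] by (auto simp: conc_def)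
  qed
  show "d p q \<subseteq> d (if d x p \<subseteq> d x v then v else p) (if d x q \<subseteq> d x v then v else q)"
    using lo(1)[OF _ _ pq] lo(2)[OF _ _ pq(2,1)] dist_self[OF vE] by simp
qed

text \<open>\<open>d x\<close> shrinks from \<open>UNIV\<close> at \<open>x\<close> to
  \<open>F\<close> at \<open>y\<close>, so \<open>v\<close> is the end towards
  \<open>x\<close>.\<close>

definition interval :: "'p \<Rightarrow> 'p \<Rightarrow> 'p set" where
  "interval v v' = {e \<in> E. d x v' \<subseteq> d x e \<and> d x e \<subseteq> d x v}"

text \<open>A retract of an injective space is injective: the extension into \<open>E\<close> is
  followed by the collapse of the side of \<open>x\<close> to \<open>v\<close> and then of the side
  of \<open>y\<close> to \<open>v'\<close>.\<close>

lemma injective_interval: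
  assumes v: "splits v" "splits v'" and sub: "d x v' \<subseteq> d x v"
  shows "injective_space bar (interval v v') d"
  unfolding injective_space_def
proof (intro conjI allI impI)
  have CE: "interval v v' \<subseteq> E" by (auto simp: interval_def)
  show "vmetric bar (interval v v') d"
    using vmetric_env CE by (rule vmetric_subset)
  fix E' E'' :: "'p option set" and d' d'' g f
  assume H: "vmetric bar E' d' \<and> vmetric bar E'' d'' \<and> isometry E' d' E'' d'' g \<and>
    nonexpansive E' d' (interval v v') d f"
  then have "nonexpansive E' d' E d f" using CE unfolding nonexpansive_def by blast
  then obtain h where h: "nonexpansive E'' d'' E d h" "\<forall>u\<in>E'. h (g u) = f u"
    using H injective unfolding injective_space_def by blast
  define r1 where "r1 = (\<lambda>e. if d x v \<subseteq> d x e then v else e)"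
  define r2 where "r2 = (\<lambda>e. if d x e \<subseteq> d x v' then v' else e)"
  have r1: "r1 e \<in> E" "d x (r1 e) \<subseteq> d x v" if "e \<in> E" for e
    using splits_comparable[OF v(1) that] splits_in[OF v(1)] that by (auto simp: r1_def)
  have r2: "r2 e \<in> interval v v'" if "e \<in> E" "d x e \<subseteq> d x v" for e
    using splits_comparable[OF v(2) that(1)] splits_in[OF v(2)] that sub
    by (auto simp: r2_def interval_def)
  have fix1: "r2 (r1 e) = e" if "e \<in> interval v v'" for e
  proof -
    have "e \<in> E" "d x v' \<subseteq> d x e" "d x e \<subseteq> d x v" using that by (auto simp: interval_def)
    then have "r1 e = e" "r2 e = e"
      using dist_x_inj[of e v] dist_x_inj[of e v'] splits_in[OF v(1)] splits_in[OF v(2)]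
      unfolding r1_def r2_def by auto
    then show ?thesis by simp
  qed
  have "d p q \<subseteq> d (r1 p) (r1 q)" "d p q \<subseteq> d (r2 p) (r2 q)" if "p \<in> E" "q \<in> E" for p q
    using splits_retract_upper[OF v(1)] splits_retract_lower[OF v(2)] that
    unfolding nonexpansive_def r1_def r2_def by blast+
  then have "d p q \<subseteq> d (r2 (r1 p)) (r2 (r1 q))" if "p \<in> E" "q \<in> E" for p q
    using that r1(1) by (meson subset_trans)
  moreover have hE: "h u \<in> E" if "u \<in> E''" for u
    using h(1) that by (auto simp: nonexpansive_def)
  moreover have "d'' u w \<subseteq> d (h u) (h w)" if "u \<in> E''" "w \<in> E''" for u w
    using h(1) that by (simp add: nonexpansive_def)
  ultimately have "d'' u w \<subseteq> d (r2 (r1 (h u))) (r2 (r1 (h w)))" if "u \<in> E''" "w \<in> E''" for u w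
    using that by (meson subset_trans)
  then have "nonexpansive E'' d'' (interval v v') d (r2 \<circ> r1 \<circ> h)"
    using r2[OF r1] hE by (simp add: nonexpansive_def image_subset_iff)
  moreover have "(r2 \<circ> r1 \<circ> h) (g u) = f u" if "u \<in> E'" for u
  proof -
    have "f u \<in> interval v v'" using H that unfolding nonexpansive_def by blast
    then show ?thesis using fix1 h(2) that by simp
  qed
  ultimately show "\<exists>h. nonexpansive E'' d'' (interval v v') d h \<and> (\<forall>u\<in>E'. h (g u) = f u)" by blast
qed

text \<open>Essentiality: a map \<open>g\<close> preserving the distance of the ends cannot enlarge
  another one, since every word between \<open>g p\<close> and \<open>g q\<close>, continued to
  \<open>x\<close> and \<open>y\<close>, still gives words of \<open>F\<close>;
  \<open>mem_distI\<close> then puts it in \<open>d p q\<close>.\<close>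

lemma interval_envelope:
  assumes v: "splits v" "splits v'" and sub: "d x v' \<subset> d x v"
  shows "pair_env bar (d v v') (interval v v') d v v'"
proof
  let ?C = "interval v v'"
  note vE = splits_in[OF v(1)] splits_in[OF v(2)]
  show "order_involution bar" by (rule bar)
  show fin: "final_segment (d v v')" using final_dist vE by blast
  show ne: "d v v' \<noteq> UNIV" using dist_UNIV_iff[OF vE] sub by blast
  have vC: "v \<in> ?C" "v' \<in> ?C" using vE sub by (auto simp: interval_def)
  have "isometry ?C d G dG g"
    if G: "vmetric bar G dG" "nonexpansive ?C d G dG g" "dG (g v) (g v') = d v v'"
    for G :: "'p set" and dG g
  proof -
    have gG: "g p \<in> G" if "p \<in> ?C" for p using G(2) that by (auto simp: nonexpansive_def)
    have tri: "u @ w \<in> dG (g p) (g q)" if "u \<in> dG (g p) (g r)" "w \<in> dG (g r) (g q)"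
      "p \<in> ?C" "q \<in> ?C" "r \<in> ?C" for u w p q r
    proof -
      have "conc (dG (g p) (g r)) (dG (g r) (g q)) \<subseteq> dG (g p) (g q)"
        using G(1) gG[OF that(3)] gG[OF that(4)] gG[OF that(5)] unfolding vmetric_def by blast
      then show ?thesis using that(1,2) unfolding conc_def by blast
    qed
    \<comment> \<open>\<open>u\<close> passes \<open>v\<close> and \<open>t\<close> passes
      \<open>v'\<close>; what lies between belongs to \<open>dG (g v) (g v')\<close>, that is, to
      \<open>d v v'\<close>.\<close>
    have *: "u @ w @ t \<in> F" if pq: "p \<in> ?C" "q \<in> ?C" and w: "w \<in> dG (g p) (g q)"
      and ut: "u \<in> d x p" "t \<in> d q y" for p q u w t
    proof -
      have E: "p \<in> E" "q \<in> E" and le: "d x p \<subseteq> d x v" "d x v' \<subseteq> d x q"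
        using pq by (auto simp: interval_def)
      have "d x p = conc (d x v) (d v p)"
        by (rule splits_dist(1)[OF v(1) x_in E(1) _ le(1)]) simp
      then obtain u1 u2 where u: "u = u1 @ u2" "u1 \<in> d x v" "u2 \<in> d v p"
        using ut(1) by (auto simp: conc_def)
      have "d x y \<subseteq> d x v'" using F_subset_dist_x[OF vE(2)] dist_xy by simp
      then have "d q y = conc (d q v') (d v' y)"
        by (rule splits_dist(1)[OF v(2) E(2) y_in le(2)])
      then obtain t1 t2 where t: "t = t1 @ t2" "t1 \<in> d q v'" "t2 \<in> d v' y"
        using ut(2) by (auto simp: conc_def)
      have ut: "u2 \<in> dG (g v) (g p)" "t1 \<in> dG (g q) (g v')"
        using G(2) u(3) t(2) pq vC unfolding nonexpansive_def by blast+
      have "w @ t1 \<in> dG (g p) (g v')" using tri[OF w ut(2) pq(1) vC(2) pq(2)] .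
      then have "u2 @ w @ t1 \<in> dG (g v) (g v')"
        by (rule tri[OF ut(1) _ vC pq(1)])
      then have "(u2 @ w @ t1) @ t2 \<in> d v y"
        unfolding G(3) by (rule dist_triangle[OF vE(1) y_in vE(2) _ t(3)])
      then have "u1 @ (u2 @ w @ t1) @ t2 \<in> F"
        unfolding dist_xy[symmetric] by (rule dist_triangle[OF x_in y_in vE(1) u(2)])
      then show ?thesis using u(1) t(1) by simp
    qed
    have "w \<in> d p q" if pq: "p \<in> ?C" "q \<in> ?C" and w: "w \<in> dG (g p) (g q)" for p q w
    proof (rule mem_distI)
      show "p \<in> E" "q \<in> E" using pq by (auto simp: interval_def)
      have "dG (g p) (g q) = bar_set bar (dG (g q) (g p))"
        using G(1) gG[OF pq(1)] gG[OF pq(2)] unfolding vmetric_def by blast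
      then have "bar_word bar w \<in> dG (g q) (g p)" using w mem_bar_set_iff[OF bar] by blast
      then show "u @ bar_word bar w @ t \<in> F" if "u \<in> d x q" "t \<in> d p y" for u t
        using *[OF pq(2,1)] that by blast
    qed (use *[OF pq w] in blast)
    then have "dG (g p) (g q) = d p q" if "p \<in> ?C" "q \<in> ?C" for p q
      using G(2) that unfolding nonexpansive_def by blast
    then show ?thesis using gG unfolding isometry_def by blast
  qed
  then show "pair_envelope bar (d v v') ?C d v v'"
    unfolding pair_envelope_iff[OF bar fin ne]
    using injective_interval[OF v psubset_imp_subset[OF sub]] vC by simp
qed

lemma restrict_trans_interval:
  "restrict_trans (space_trans E d) (interval v v') = space_trans (interval v v') d"
  by (auto simp: restrict_trans_def space_trans_def interval_def)

lemma graph_interval: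
  "graph \<inter> interval v v' \<times> interval v v' =
    trans_graph (space_trans (interval v v') d) \<inter> interval v v' \<times> interval v v'"
  by (auto simp: trans_graph_def space_trans_def interval_def)

text \<open>If \<open>B\<close> had points strictly on both sides, no edge would jump across
  \<open>v\<close>: either \<open>v\<close> is a cut vertex of \<open>B\<close>, or \<open>v\<close>
  is missing and \<open>B\<close> is disconnected.\<close>

lemma splits_one_side:
  assumes v: "splits v" and B: "B \<subseteq> E" "connected_graph B graph" "\<nexists>z. cut_vertex B graph z"
  shows "(\<forall>e\<in>B. d x e \<subseteq> d x v) \<or> (\<forall>e\<in>B. d x v \<subseteq> d x e)"
proof (rule ccontr)
  assume "\<not> ?thesis"
  then obtain p q where pq: "p \<in> B" "\<not> d x p \<subseteq> d x v" "q \<in> B" "\<not> d x v \<subseteq> d x q" by blast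
  define A where "A = {e \<in> B - {v}. d x v \<subseteq> d x e}"
  have p: "p \<in> A" using pq splits_comparable[OF v] B(1) unfolding A_def by blast
  have q: "q \<in> B - {v}" "q \<notin> A" using pq unfolding A_def by blast+
  have A: "A \<subseteq> B - {v}" by (auto simp: A_def)
  have closed: "t \<in> A" if "s \<in> A" "t \<in> B - {v}" "(s, t) \<in> graph" for s t
    using splits_closed[OF v, of s t] that B(1) unfolding A_def by blast
  show False
  proof (cases "v \<in> B")
    case True
    have "cut_vertex B graph v"
      by (rule cut_vertexI[OF B(2) True A]) (use p q closed in blast)+
    then show False using B(3) by blast
  next
    case False
    then have "A = B" using connected_graph_closed[OF B(2), of A] A p closed by blast
    then show False using q by blast
  qed
qed

end

text \<open>Both state sets are identified with the closed segments of \<open>F\<close> by the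
  distance from the initial state, and \<open>dist_eq\<close> recovers all distances from
  it.\<close>

lemma pair_env_isomorphic:
  assumes "pair_env bar F E d x y" "pair_env bar F E' d' x' y'"
  shows "automata_isomorphic (mk_automaton E (space_trans E d) {x} {y})
    (mk_automaton E' (space_trans E' d') {x'} {y'})"
proof -
  interpret A: pair_env bar F E d x y by fact
  interpret B: pair_env bar F E' d' x' y' by fact
  define \<phi> where "\<phi> = inv_into E' (d' x') \<circ> d x"
  have bij: "bij_betw \<phi> E E'"
    unfolding \<phi>_def using A.dist_x_bij bij_betw_inv_into[OF B.dist_x_bij] by (rule bij_betw_trans)
  have \<phi>E: "\<phi> p \<in> E'" if "p \<in> E" for p using bij that by (auto simp: bij_betw_def)
  have \<phi>: "d' x' (\<phi> p) = d x p" if "p \<in> E" for p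
  proof -
    have "d x p \<in> d' x' ` E'"
      using A.dist_x_bij B.dist_x_bij that by (auto simp: bij_betw_def)
    then show ?thesis by (simp add: \<phi>_def f_inv_into_f)
  qed
  have dist: "d' (\<phi> p) (\<phi> q) = d p q" if "p \<in> E" "q \<in> E" for p q
    unfolding A.dist_eq[OF that] B.dist_eq[OF \<phi>E[OF that(1)] \<phi>E[OF that(2)]] \<phi>[OF that(1)] \<phi>[OF that(2)] ..
  have "\<phi> x = x'" "\<phi> y = y'"
    using B.dist_x_inj[OF \<phi>E B.x_in] B.dist_x_inj[OF \<phi>E B.y_in] \<phi>[of x] \<phi>[of y]
    by (simp_all add: A.dist_xy B.dist_xy)
  moreover have "\<phi> p = \<phi> q \<longleftrightarrow> p = q" if "p \<in> E" "q \<in> E" for p q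
    using bij that by (auto simp: bij_betw_def inj_on_def)
  ultimately show ?thesis
    unfolding automata_isomorphic_def mk_automaton_def
    using bij \<phi>E dist by (intro exI[of _ \<phi>]) (auto simp: space_trans_def)
qed

section \<open>The chain of blocks\<close>

text \<open>The \<open>n + 1\<close> points bound \<open>n\<close> intervals, hence
  \<open>i \<le> n\<close> for the points and \<open>i < n\<close> for the steps.\<close>

locale split_chain = pair_env +
  fixes v :: "nat \<Rightarrow> 'b" and n :: nat
  assumes nonempty: "F \<noteq> {}" and n_pos: "0 < n"
    and splits_v: "i \<le> n \<Longrightarrow> splits (v i)"
    and v_step: "i < n \<Longrightarrow> d x (v (Suc i)) \<subset> d x (v i)"
    and v_0: "v 0 = x" and v_n: "v n = y"
    and irreducible: "i < n \<Longrightarrow> irreducible_segment (d (v i) (v (Suc i)))"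
begin

lemma v_in: "i \<le> n \<Longrightarrow> v i \<in> E"
  using splits_v splits_in by blast

lemma dist_x_v_less: "i < j \<Longrightarrow> j \<le> n \<Longrightarrow> d x (v j) \<subset> d x (v i)"
proof (induction j)
  case (Suc j)
  then show ?case
    using v_step[of j] by (cases "i = j") (auto dest: less_SucE)
qed simp

lemma dist_x_v_le_iff: "i \<le> n \<Longrightarrow> j \<le> n \<Longrightarrow> d x (v i) \<subseteq> d x (v j) \<longleftrightarrow> j \<le> i"
  using dist_x_v_less[of i j] dist_x_v_less[of j i] by (cases i j rule: linorder_cases) auto

definition chain_block :: "nat \<Rightarrow> 'b set" where
  "chain_block i = interval (v i) (v (Suc i))"

lemma mem_chain_block_iff:
  "e \<in> chain_block i \<longleftrightarrow> e \<in> E \<and> d x (v (Suc i)) \<subseteq> d x e \<and> d x e \<subseteq> d x (v i)"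
  by (simp add: chain_block_def interval_def)

lemma chain_block_subset: "chain_block i \<subseteq> E"
  by (auto simp: mem_chain_block_iff)

lemma v_mem_chain_block_iff: "i \<le> n \<Longrightarrow> j < n \<Longrightarrow> v i \<in> chain_block j \<longleftrightarrow> i = j \<or> i = Suc j"
  using v_in by (auto simp: mem_chain_block_iff dist_x_v_le_iff)

lemma chain_block_envelope:
  "i < n \<Longrightarrow> pair_env bar (d (v i) (v (Suc i))) (chain_block i) d (v i) (v (Suc i))"
  unfolding chain_block_def by (intro interval_envelope splits_v v_step) auto

text \<open>The interval is the envelope of an irreducible segment, so the equivalence already
  proved applies to it.\<close>

lemma chain_block_graph:
  assumes "i < n"
  shows "connected_graph (chain_block i) graph" "\<nexists>z. cut_vertex (chain_block i) graph z"
proof -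
  interpret C: pair_env bar "d (v i) (v (Suc i))" "chain_block i" d "v i" "v (Suc i)"
    using chain_block_envelope[OF assms] .
  have eq: "graph \<inter> chain_block i \<times> chain_block i = C.graph \<inter> chain_block i \<times> chain_block i"
    unfolding chain_block_def by (rule graph_interval)
  have "d (v i) (v (Suc i)) \<noteq> {}"
    using dist_nonempty[OF nonempty] v_in assms by simp
  then show "connected_graph (chain_block i) graph"
    using C.connected_graph connected_graph_cong[OF eq] by blast
  show "\<nexists>z. cut_vertex (chain_block i) graph z"
    using C.irreducible_segment_iff_space C.irreducible_space_iff_no_cut_vertex irreducible[OF assms]
      cut_vertex_cong[OF eq] by blast
qed

text \<open>Take the largest \<open>i\<close> with \<open>D\<close> beyond \<open>v i\<close> as
  seen from \<open>x\<close>; by maximality and \<open>splits_one_side\<close>, \<open>D\<close>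
  does not go past the next point. For the last interval this holds since \<open>F\<close> is
  contained in every \<open>d x e\<close>.\<close>

lemma exists_chain_block:
  assumes D: "D \<subseteq> E" "connected_graph D graph" "\<nexists>z. cut_vertex D graph z"
  shows "\<exists>i<n. D \<subseteq> chain_block i"
proof -
  let ?Q = "\<lambda>i. i < n \<and> (\<forall>e\<in>D. d x e \<subseteq> d x (v i))"
  have "?Q 0" using n_pos v_0 by simp
  then obtain i where i: "?Q i" "\<And>j. ?Q j \<Longrightarrow> j \<le> i"
    using ex_has_greatest_nat[of ?Q 0 "\<lambda>i. i" n] by (metis (no_types, lifting) less_imp_le)
  have "\<forall>e\<in>D. d x (v (Suc i)) \<subseteq> d x e"
  proof (cases "Suc i = n")
    case True
    then show ?thesis using F_subset_dist_x D(1) v_n dist_xy by auto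
  next
    case False
    then have "Suc i < n" using i(1) by simp
    then show ?thesis
      using splits_one_side[OF splits_v D, of "Suc i"] i(2)[of "Suc i"] by auto
  qed
  then have "D \<subseteq> chain_block i" using i(1) D(1) by (auto simp: mem_chain_block_iff)
  then show ?thesis using i(1) by blast
qed

lemma chain_block_mono_imp_eq:
  assumes "i < n" "j < n" "chain_block i \<subseteq> chain_block j" shows "i = j"
proof -
  have "v i \<in> chain_block i" "v (Suc i) \<in> chain_block i"
    using assms(1) by (simp_all add: v_mem_chain_block_iff)
  then have "v i \<in> chain_block j" "v (Suc i) \<in> chain_block j" using assms(3) by blast+
  then show ?thesis using assms(1,2) by (auto simp: v_mem_chain_block_iff)
qed

text \<open>The intervals are connected without cut vertex, every such subgraph lies in one of them,
  and none contains another.\<close>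

lemma block_iff: "block E graph B \<longleftrightarrow> (\<exists>i<n. B = chain_block i)"
proof
  assume B: "block E graph B"
  then obtain i where i: "i < n" "B \<subseteq> chain_block i"
    using exists_chain_block[of B] unfolding block_def by auto
  have "\<forall>D. B \<subseteq> D \<and> D \<subseteq> E \<and> connected_graph D graph \<and> (\<nexists>z. cut_vertex D graph z) \<longrightarrow> D = B"
    using B by (simp add: block_def)
  from this[rule_format, of "chain_block i"] have "chain_block i = B"
    using i(2) chain_block_subset chain_block_graph[OF i(1)] by simp
  then show "\<exists>i<n. B = chain_block i" using i(1) by blast
next
  assume "\<exists>i<n. B = chain_block i"
  then obtain i where i: "i < n" "B = chain_block i" by blast
  have "D = B" if D: "B \<subseteq> D" "D \<subseteq> E" "connected_graph D graph" "\<nexists>z. cut_vertex D graph z" for D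
  proof -
    obtain j where j: "j < n" "D \<subseteq> chain_block j" using exists_chain_block[OF D(2-4)] by blast
    then have "i = j" using chain_block_mono_imp_eq[OF i(1)] D(1) i(2) by blast
    then show ?thesis using D(1) j(2) i(2) by blast
  qed
  moreover have "B \<subseteq> E" "connected_graph B graph" "\<nexists>z. cut_vertex B graph z"
    using i chain_block_subset chain_block_graph[OF i(1)] by simp_all
  ultimately show "block E graph B" unfolding block_def by simp
qed

lemma bij_betw_chain_block: "bij_betw chain_block {..<n} {B. block E graph B}"
  unfolding bij_betw_def inj_on_def block_iff using chain_block_mono_imp_eq by blast

lemma chain_block_Int_Suc:
  assumes "Suc i < n" shows "chain_block i \<inter> chain_block (Suc i) = {v (Suc i)}"
proof -
  have "e = v (Suc i)" if "e \<in> chain_block i" "e \<in> chain_block (Suc i)" for e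
    using that dist_x_inj[of e "v (Suc i)"] v_in assms by (auto simp: mem_chain_block_iff)
  moreover have "v (Suc i) \<in> chain_block i \<inter> chain_block (Suc i)"
    using assms by (simp add: v_mem_chain_block_iff)
  ultimately show ?thesis by blast
qed

lemma chain_block_Int_distant:
  assumes "Suc i < j" "j < n" shows "chain_block i \<inter> chain_block j = {}"
proof -
  have "d x (v j) \<subset> d x (v (Suc i))" using dist_x_v_less[OF assms(1)] assms(2) by simp
  then show ?thesis unfolding set_eq_iff Int_iff mem_chain_block_iff by blast
qed

text \<open>The interval itself is an envelope of its factor; any other one is isomorphic to
  it.\<close>

lemma chain_block_automaton:
  fixes E' :: "'b set"
  assumes "i < n" and Fi: "Fi = d (v i) (v (Suc i))"
  shows "\<exists>(E' :: 'b set) d' x' y'. pair_envelope bar Fi E' d' x' y'"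
    and "pair_envelope bar Fi E' d' x' y' \<Longrightarrow>
      accepted (mk_automaton E' (space_trans E' d') {x'} {y'}) = Fi \<and>
      automata_isomorphic (mk_automaton E' (space_trans E' d') {x'} {y'})
        (mk_automaton (chain_block i) (restrict_trans (space_trans E d) (chain_block i)) {v i} {v (Suc i)})"
proof -
  note C = chain_block_envelope[OF assms(1), folded Fi]
  interpret C: pair_env bar Fi "chain_block i" d "v i" "v (Suc i)" by (rule C)
  show "\<exists>(E' :: 'b set) d' x' y'. pair_envelope bar Fi E' d' x' y'" using C.env by blast
  assume "pair_envelope bar Fi E' d' x' y'"
  then have B: "pair_env bar Fi E' d' x' y'" using bar C.F by unfold_locales
  then show "accepted (mk_automaton E' (space_trans E' d') {x'} {y'}) = Fi \<and>
      automata_isomorphic (mk_automaton E' (space_trans E' d') {x'} {y'})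
        (mk_automaton (chain_block i) (restrict_trans (space_trans E d) (chain_block i)) {v i} {v (Suc i)})"
    using pair_env.accepted_eq[OF B] pair_env_isomorphic[OF B C]
    by (simp add: chain_block_def restrict_trans_interval)
qed

end

section \<open>The chain obtained from a factorization into irreducibles\<close>

context pair_env
begin

text \<open>The point \<open>v i\<close> belongs to the product of the first \<open>i\<close>
  factors: the empty product \<open>UNIV\<close> gives \<open>x\<close>, and the full product
  \<open>F\<close> gives \<open>y\<close>.\<close>

lemma exists_split_chain:
  assumes "\<not> irreducible_segment F"
  obtains L v where "length L \<ge> 2" "conc_list L = F" "\<And>X. X \<in> set L \<Longrightarrow> irreducible_segment X"
    "split_chain bar F E d x y v (length L)" "\<And>i. i < length L \<Longrightarrow> d (v i) (v (Suc i)) = L ! i"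
proof -
  \<comment> \<open>A product is empty only if a factor is, so a reducible \<open>F\<close> is
    nonempty.\<close>
  have "irreducible_segment {}"
    unfolding irreducible_segment_def final_segment_def
    by (metis conc_empty_iff empty_iff UNIV_not_empty)
  then have ne: "F \<noteq> {}" using assms by auto
  obtain L where L: "L \<noteq> []" "\<forall>X\<in>set L. irreducible_segment X" "conc_list L = F"
    using irreducible_factorization[OF F ne] by blast
  let ?n = "length L" and ?P = "\<lambda>i. conc_list (take i L)" and ?S = "\<lambda>i. conc_list (drop i L)"
  have finL: "\<forall>X\<in>set L. final_segment X" using L(2) by (auto simp: irreducible_segment_def)
  have fin: "final_segment (?P i)" "final_segment (?S i)" for i
    using finL by (auto intro!: final_segment_conc_list dest: in_set_takeD in_set_dropD)
  have PS: "conc (?P i) (?S i) = F" for i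
    using conc_list_append[of "drop i L" "take i L"] finL L(3) by (auto dest: in_set_dropD)
  have neP: "?P i \<noteq> {}" for i using PS[of i] ne conc_empty_iff by metis
  have "\<exists>v. splits v \<and> d x v = ?P i" for i
    using exists_split[OF fin PS[symmetric] ne] by blast
  then obtain v where v: "splits (v i)" "d x (v i) = ?P i" for i by metis
  have P_Suc: "?P (Suc i) = conc (?P i) (L ! i)" if "i < ?n" for i
  proof -
    have "final_segment (L ! i)" using finL that by simp
    then show ?thesis
      using conc_list_append[of "[L ! i]" "take i L"] that
      by (simp add: take_Suc_conv_app_nth conc_UNIV_right)
  qed
  have step: "d x (v (Suc i)) \<subset> d x (v i)" if "i < ?n" for i
  proof -
    have "irreducible_segment (L ! i)" using L(2) that by simp
    then show ?thesis
      using conc_left_proper[OF fin(1)[of i], of "L ! i"] neP[of "Suc i"] P_Suc[OF that] v(2)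
      by (simp add: irreducible_segment_def)
  qed
  \<comment> \<open>Cancelling a prefix product from the next one leaves the factor
    \<open>L ! i\<close>.\<close>
  have dist: "d (v i) (v (Suc i)) = L ! i" if "i < ?n" for i
  proof -
    have "final_segment (L ! i)" using finL that by simp
    then show ?thesis
      using dist_antimono[OF splits_in splits_in, OF v(1) v(1) psubset_imp_subset[OF step[OF that]]]
        residual_conc[OF _ neP] P_Suc[OF that] v(2) by simp
  qed
  have "v 0 = x" using dist_x_inj[OF splits_in[OF v(1)] x_in, of 0] v(2)[of 0] by simp
  moreover have "v ?n = y"
    using dist_x_inj[OF splits_in[OF v(1)] y_in, of ?n] v(2)[of ?n] L(3) dist_xy by simp
  ultimately have "split_chain bar F E d x y v ?n"
    using v(1) step ne L(1,2) dist by unfold_locales auto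
  moreover have "?n \<noteq> 1"
  proof
    assume "?n = 1"
    then obtain X where "L = [X]" by (auto simp: length_Suc_conv)
    then show False using assms L(2,3) finL by (simp add: conc_UNIV_right)
  qed
  then have "?n \<ge> 2" using L(1) by (cases ?n) auto
  ultimately show ?thesis using that L dist by blast
qed

end

theorem theorem4:
  fixes bar :: "'a::order \<Rightarrow> 'a"
    and F :: "'a list set"
    and E :: "'p set"
    and d :: "'p \<Rightarrow> 'p \<Rightarrow> 'a list set"
    and x y :: 'p
  assumes "order_involution bar"
    and "final_segment F"
    and "F \<noteq> UNIV"
    and "pair_envelope bar F E d x y"
  shows "(accepted (mk_automaton E (space_trans E d) {x} {y}) = F) \<and>
    (irreducible_segment F \<longleftrightarrow> irreducible_space E d) \<and>
    (irreducible_space E d \<longleftrightarrow> (\<nexists>v. cut_vertex E (trans_graph (space_trans E d)) v)) \<and>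
    (\<not> irreducible_segment F \<longrightarrow>
      (\<exists>(n::nat) (C :: nat \<Rightarrow> 'p set) (Fs :: nat \<Rightarrow> 'a list set) (xs :: nat \<Rightarrow> 'p) (ys :: nat \<Rightarrow> 'p).
        n \<ge> 2 \<and>
        bij_betw C {..<n} {B. block E (trans_graph (space_trans E d)) B} \<and>
        xs 0 = x \<and> ys (n - 1) = y \<and>
        (\<forall>i. 1 \<le> i \<and> i < n \<longrightarrow> C (i - 1) \<inter> C i = {xs i}) \<and>
        (\<forall>i. i + 1 < n \<longrightarrow> C i \<inter> C (i + 1) = {ys i}) \<and>
        (\<forall>i j. i + 1 < j \<and> j < n \<longrightarrow> C i \<inter> C j = {}) \<and>
        x \<in> C 0 \<and> y \<in> C (n - 1) \<and>
        (\<forall>i<n. final_segment (Fs i) \<and> Fs i \<noteq> UNIV) \<and>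
        F = conc_list (map Fs [0..<n]) \<and>
        (\<forall>i<n.
          (\<exists>(E' :: 'p set) d' x' y'. pair_envelope bar (Fs i) E' d' x' y') \<and>
          (\<forall>(E' :: 'p set) d' x' y'. pair_envelope bar (Fs i) E' d' x' y' \<longrightarrow>
             accepted (mk_automaton E' (space_trans E' d') {x'} {y'}) = Fs i \<and>
             automata_isomorphic
               (mk_automaton E' (space_trans E' d') {x'} {y'})
               (mk_automaton (C i) (restrict_trans (space_trans E d) (C i)) {xs i} {ys i})))))"
proof -
  interpret pair_env bar F E d x y by unfold_locales fact+
  have "\<exists>(n::nat) (C :: nat \<Rightarrow> 'p set) (Fs :: nat \<Rightarrow> 'a list set) (xs :: nat \<Rightarrow> 'p) (ys :: nat \<Rightarrow> 'p).
        n \<ge> 2 \<and>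
        bij_betw C {..<n} {B. block E (trans_graph (space_trans E d)) B} \<and>
        xs 0 = x \<and> ys (n - 1) = y \<and>
        (\<forall>i. 1 \<le> i \<and> i < n \<longrightarrow> C (i - 1) \<inter> C i = {xs i}) \<and>
        (\<forall>i. i + 1 < n \<longrightarrow> C i \<inter> C (i + 1) = {ys i}) \<and>
        (\<forall>i j. i + 1 < j \<and> j < n \<longrightarrow> C i \<inter> C j = {}) \<and>
        x \<in> C 0 \<and> y \<in> C (n - 1) \<and>
        (\<forall>i<n. final_segment (Fs i) \<and> Fs i \<noteq> UNIV) \<and>
        F = conc_list (map Fs [0..<n]) \<and>
        (\<forall>i<n.
          (\<exists>(E' :: 'p set) d' x' y'. pair_envelope bar (Fs i) E' d' x' y') \<and>
          (\<forall>(E' :: 'p set) d' x' y'. pair_envelope bar (Fs i) E' d' x' y' \<longrightarrow>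
             accepted (mk_automaton E' (space_trans E' d') {x'} {y'}) = Fs i \<and>
             automata_isomorphic
               (mk_automaton E' (space_trans E' d') {x'} {y'})
               (mk_automaton (C i) (restrict_trans (space_trans E d) (C i)) {xs i} {ys i})))"
    if red: "\<not> irreducible_segment F"
  proof -
    obtain L v where L: "length L \<ge> 2" "conc_list L = F" "\<And>X. X \<in> set L \<Longrightarrow> irreducible_segment X"
      and chain: "split_chain bar F E d x y v (length L)"
      and dist: "\<And>i. i < length L \<Longrightarrow> d (v i) (v (Suc i)) = L ! i"
      using exists_split_chain[OF red] by blast
    interpret split_chain bar F E d x y v "length L" by (rule chain)
    have Suc_n: "Suc (length L - 1) = length L" using L(1) by simp
    show ?thesis
    \<comment> \<open>Entry and exit points are one sequence shifted by one: block \<open>i\<close>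
      runs from \<open>v i\<close> to \<open>v (Suc i)\<close>.\<close>
    proof (rule exI[of _ "length L"], rule exI[of _ chain_block], rule exI[of _ "\<lambda>i. L ! i"],
        rule exI[of _ v], rule exI[of _ "\<lambda>i. v (Suc i)"], intro conjI allI impI)
      show "chain_block (i - 1) \<inter> chain_block i = {v i}" if "1 \<le> i \<and> i < length L" for i
        using chain_block_Int_Suc[of "i - 1"] that by simp
      show "x \<in> chain_block 0" using v_mem_chain_block_iff[of 0 0] v_0 n_pos by simp
      show "y \<in> chain_block (length L - 1)"
        using v_mem_chain_block_iff[of "length L" "length L - 1"] v_n n_pos by simp
      show "v (Suc (length L - 1)) = y" using v_n Suc_n by simp
      show "final_segment (L ! i)" "L ! i \<noteq> UNIV" if "i < length L" for i
        using L(3)[of "L ! i"] that by (auto simp: irreducible_segment_def)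
      show "F = conc_list (map ((!) L) [0..<length L])" using L(2) by (simp add: map_nth)
      fix i assume i: "i < length L"
      note block_i = chain_block_automaton[OF i dist[OF i, symmetric]]
      show "\<exists>(E' :: 'p set) d' x' y'. pair_envelope bar (L ! i) E' d' x' y'" by (rule block_i(1))
      fix E' :: "'p set" and d' x' y' assume "pair_envelope bar (L ! i) E' d' x' y'"
      note block_i(2)[OF this]
      then show "accepted (mk_automaton E' (space_trans E' d') {x'} {y'}) = L ! i"
        "automata_isomorphic (mk_automaton E' (space_trans E' d') {x'} {y'})
          (mk_automaton (chain_block i) (restrict_trans (space_trans E d) (chain_block i)) {v i} {v (Suc i)})"
        by blast+
    qed (use L(1) bij_betw_chain_block v_0 chain_block_Int_Suc chain_block_Int_distant in simp_all)
  qed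
  then show ?thesis
    using accepted_eq irreducible_segment_iff_space irreducible_space_iff_no_cut_vertex by blast
qed

end
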